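(* Let $\mathcal{C}$ be a generalized near-group fusion category of type $(G,\Gamma,k_1,\dots,k_n)$. Assume that $(k_1,\dots,k_n)\neq(0,\dots,0)$. Then: (1) The adjoint subcategory $\mathcal{C}_{ad}$ is non-pointed. There is a one-to-one correspondence between the non-pointed fusion subcategories of $\mathcal{C}$ and the subgroups of the universal grading group $\mathcal{U}(\mathcal{C})$. (2) Every component $\mathcal{C}_g$ ($g\in\mathcal{U}(\mathcal{C})$) of the universal grading contains at least one invertible simple object $\delta$. In particular, $\operatorname{Irr}(\mathcal{C}_g)=\{\delta\otimes X_{i_1},\dots,\delta\otimes X_{i_s}\}$, where $\operatorname{Irr}(\mathcal{C}_{ad})=\{X_{i_1},\dots,X_{i_s}\}$.
   Context: Fusion categories are over an algebraically closed field of characteristic $0$. $\operatorname{Irr}(\cdot)$ is the set of isomorphism classes of simple objects; $G=G(\mathcal{C})$ is the group of invertible simple objects. A generalized near-group fusion category is a non-pointed fusion category $\mathcal{C}$ such that $G$, acting by left tensor product, acts transitively on $\operatorname{Irr}(\mathcal{C})\setminus G=\{X_1,\dots,X_n\}$. It is of type $(G,\Gamma,k_1,\dots,k_n)$ if $\Gamma$ is the stabilizer of $X_1$ in $G$ and $X_1\otimes X_1^*=\bigoplus_{h\in\Gamma}h\oplus k_1X_1\oplus\cdots\oplus k_nX_n$. The universal grading $\mathcal{C}=\bigoplus_{g\in\mathcal{U}(\mathcal{C})}\mathcal{C}_g$ is the canonical faithful grading with trivial component $\mathcal{C}_e=\mathcal{C}_{ad}$, the adjoint subcategory generated by simple constituents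 of all $X\otimes X^*$, $X$ simple; $\mathcal{U}(\mathcal{C})$ is the universal grading group. In part (2), $X_{i_1},\dots,X_{i_s}$ denote all simple objects of $\mathcal{C}_{ad}$, invertible or not. *)

theory Defs
  imports
    "HOL-Algebra.Group_Action"
    "HOL-Computational_Algebra.Polynomial"
begin

section \<open>Linear categories\<close>

text \<open>
  The objects form the type \<open>'o\<close>.  The hom spaces are subspaces of one ambient vector space
  \<open>'m\<close> over \<open>'k\<close> (for instance of the direct sum of all of them).  They are not required to be
  disjoint, so a morphism is an element of \<open>'m\<close> taken together with its source and target.
  Composition and the tensor product of morphisms are constrained only on hom spaces.
  Every small linear category has such a presentation.
\<close>

record ('o, 'm, 'k) tensor_data =
  Hom :: "'o \<Rightarrow> 'o \<Rightarrow> 'm set"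
  scale :: "'k \<Rightarrow> 'm \<Rightarrow> 'm"
  Comp :: "'m \<Rightarrow> 'm \<Rightarrow> 'm"  (infixr "\<cdot>\<index>" 70)
  Id :: "'o \<Rightarrow> 'm"  ("Id\<index>")
  tens :: "'o \<Rightarrow> 'o \<Rightarrow> 'o"  (infixr "\<boxtimes>\<index>" 75)
  tensm :: "'m \<Rightarrow> 'm \<Rightarrow> 'm"  (infixr "\<star>\<index>" 75)
  unit_obj :: "'o"
  assoc :: "'o \<Rightarrow> 'o \<Rightarrow> 'o \<Rightarrow> 'm"
  lunit :: "'o \<Rightarrow> 'm"
  runit :: "'o \<Rightarrow> 'm"

locale linear_category = vector_space "scale C"
  for C :: "('o, 'm::ab_group_add, 'k::field) tensor_data" (structure) +
  assumes subspace_Hom: "subspace (Hom C X Y)"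
    and Comp_closed: "f \<in> Hom C X Y \<Longrightarrow> g \<in> Hom C Y Z \<Longrightarrow> g \<cdot> f \<in> Hom C X Z"
    and Comp_assoc: "f \<in> Hom C W X \<Longrightarrow> g \<in> Hom C X Y \<Longrightarrow> h \<in> Hom C Y Z \<Longrightarrow>
      (h \<cdot> g) \<cdot> f = h \<cdot> (g \<cdot> f)"
    and Id_closed: "Id X \<in> Hom C X X"
    and Comp_Id_left: "f \<in> Hom C X Y \<Longrightarrow> Id Y \<cdot> f = f"
    and Comp_Id_right: "f \<in> Hom C X Y \<Longrightarrow> f \<cdot> Id X = f"
    and Comp_add_left: "f \<in> Hom C X Y \<Longrightarrow> g \<in> Hom C Y Z \<Longrightarrow> g' \<in> Hom C Y Z \<Longrightarrow>
      (g + g') \<cdot> f = g \<cdot> f + g' \<cdot> f"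
    and Comp_add_right: "f \<in> Hom C X Y \<Longrightarrow> f' \<in> Hom C X Y \<Longrightarrow> g \<in> Hom C Y Z \<Longrightarrow>
      g \<cdot> (f + f') = g \<cdot> f + g \<cdot> f'"
    and Comp_scale_left: "f \<in> Hom C X Y \<Longrightarrow> g \<in> Hom C Y Z \<Longrightarrow>
      scale C c g \<cdot> f = scale C c (g \<cdot> f)"
    and Comp_scale_right: "f \<in> Hom C X Y \<Longrightarrow> g \<in> Hom C Y Z \<Longrightarrow>
      g \<cdot> scale C c f = scale C c (g \<cdot> f)"

definition inverse_mor :: "('o, 'm, 'k) tensor_data \<Rightarrow> 'o \<Rightarrow> 'o \<Rightarrow> 'm \<Rightarrow> 'm \<Rightarrow> bool" where
  "inverse_mor C X Y f g \<longleftrightarrow> f \<in> Hom C X Y \<and> g \<in> Hom C Y X \<and>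
     g \<cdot>\<^bsub>C\<^esub> f = Id\<^bsub>C\<^esub> X \<and> f \<cdot>\<^bsub>C\<^esub> g = Id\<^bsub>C\<^esub> Y"

definition iso_mor :: "('o, 'm, 'k) tensor_data \<Rightarrow> 'o \<Rightarrow> 'o \<Rightarrow> 'm \<Rightarrow> bool" where
  "iso_mor C X Y f \<longleftrightarrow> (\<exists>g. inverse_mor C X Y f g)"

definition isomorphic :: "('o, 'm, 'k) tensor_data \<Rightarrow> 'o \<Rightarrow> 'o \<Rightarrow> bool" where
  "isomorphic C X Y \<longleftrightarrow> (\<exists>f. iso_mor C X Y f)"

definition zero_obj :: "('o, 'm::zero, 'k) tensor_data \<Rightarrow> 'o \<Rightarrow> bool" where
  "zero_obj C X \<longleftrightarrow> Id\<^bsub>C\<^esub> X = 0"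

definition mono_mor :: "('o, 'm, 'k) tensor_data \<Rightarrow> 'o \<Rightarrow> 'o \<Rightarrow> 'm \<Rightarrow> bool" where
  "mono_mor C X Y f \<longleftrightarrow> f \<in> Hom C X Y \<and>
     (\<forall>W. \<forall>u\<in>Hom C W X. \<forall>v\<in>Hom C W X. f \<cdot>\<^bsub>C\<^esub> u = f \<cdot>\<^bsub>C\<^esub> v \<longrightarrow> u = v)"

definition epi_mor :: "('o, 'm, 'k) tensor_data \<Rightarrow> 'o \<Rightarrow> 'o \<Rightarrow> 'm \<Rightarrow> bool" where
  "epi_mor C X Y f \<longleftrightarrow> f \<in> Hom C X Y \<and>
     (\<forall>W. \<forall>u\<in>Hom C Y W. \<forall>v\<in>Hom C Y W. u \<cdot>\<^bsub>C\<^esub> f = v \<cdot>\<^bsub>C\<^esub> f \<longrightarrow> u = v)"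

definition kernel_of ::
  "('o, 'm::zero, 'k) tensor_data \<Rightarrow> 'o \<Rightarrow> 'o \<Rightarrow> 'm \<Rightarrow> 'o \<Rightarrow> 'm \<Rightarrow> bool" where
  "kernel_of C X Y f K i \<longleftrightarrow> f \<in> Hom C X Y \<and> i \<in> Hom C K X \<and> f \<cdot>\<^bsub>C\<^esub> i = 0 \<and>
     (\<forall>W. \<forall>w\<in>Hom C W X. f \<cdot>\<^bsub>C\<^esub> w = 0 \<longrightarrow> (\<exists>!u. u \<in> Hom C W K \<and> i \<cdot>\<^bsub>C\<^esub> u = w))"

definition cokernel_of ::
  "('o, 'm::zero, 'k) tensor_data \<Rightarrow> 'o \<Rightarrow> 'o \<Rightarrow> 'm \<Rightarrow> 'o \<Rightarrow> 'm \<Rightarrow> bool" where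
  "cokernel_of C X Y f Q p \<longleftrightarrow> f \<in> Hom C X Y \<and> p \<in> Hom C Y Q \<and> p \<cdot>\<^bsub>C\<^esub> f = 0 \<and>
     (\<forall>W. \<forall>w\<in>Hom C Y W. w \<cdot>\<^bsub>C\<^esub> f = 0 \<longrightarrow> (\<exists>!u. u \<in> Hom C Q W \<and> u \<cdot>\<^bsub>C\<^esub> p = w))"

text \<open>\<open>Z\<close> is the direct sum of the finite family \<open>F i\<close>, \<open>i \<in> I\<close>; a zero object if \<open>I = {}\<close>.\<close>

definition is_direct_sum ::
  "('o, 'm::ab_group_add, 'k) tensor_data \<Rightarrow> 'i set \<Rightarrow> ('i \<Rightarrow> 'o) \<Rightarrow> 'o \<Rightarrow> bool" where
  "is_direct_sum C I F Z \<longleftrightarrow> finite I \<and>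
     (\<exists>\<iota> \<pi>. (\<forall>i\<in>I. \<iota> i \<in> Hom C (F i) Z \<and> \<pi> i \<in> Hom C Z (F i)) \<and>
            (\<forall>i\<in>I. \<forall>j\<in>I. \<pi> i \<cdot>\<^bsub>C\<^esub> \<iota> j = (if i = j then Id\<^bsub>C\<^esub> (F i) else 0)) \<and>
            (\<Sum>i\<in>I. \<iota> i \<cdot>\<^bsub>C\<^esub> \<pi> i) = Id\<^bsub>C\<^esub> Z)"

definition is_summand :: "('o, 'm, 'k) tensor_data \<Rightarrow> 'o \<Rightarrow> 'o \<Rightarrow> bool" where
  "is_summand C Y Z \<longleftrightarrow> (\<exists>i\<in>Hom C Y Z. \<exists>p\<in>Hom C Z Y. p \<cdot>\<^bsub>C\<^esub> i = Id\<^bsub>C\<^esub> Y)"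

definition simple_obj :: "('o, 'm::zero, 'k) tensor_data \<Rightarrow> 'o \<Rightarrow> bool" where
  "simple_obj C X \<longleftrightarrow> \<not> zero_obj C X \<and>
     (\<forall>Y m. mono_mor C Y X m \<longrightarrow> zero_obj C Y \<or> iso_mor C Y X m)"

definition iso_class :: "('o, 'm, 'k) tensor_data \<Rightarrow> 'o \<Rightarrow> 'o set" where
  "iso_class C X = {Y. isomorphic C X Y}"

definition iso_rep :: "'o set \<Rightarrow> 'o" where
  "iso_rep A = (SOME X. X \<in> A)"

text \<open>
  Full subcategories are given by their sets of objects.  \<open>Irr C S\<close> is the set of isomorphism
  classes of simple objects of \<open>C\<close> lying in \<open>S\<close>; thus \<open>Irr C UNIV\<close> is \<open>Irr(C)\<close>.
\<close>

definition Irr :: "('o, 'm::zero, 'k) tensor_data \<Rightarrow> 'o set \<Rightarrow> 'o set set" where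
  "Irr C S = {iso_class C X | X. X \<in> S \<and> simple_obj C X}"

locale abelian_linear_category = linear_category +
  assumes ex_direct_sum: "finite I \<Longrightarrow> \<exists>Z. is_direct_sum C (I :: nat set) F Z"
    and ex_kernel: "f \<in> Hom C X Y \<Longrightarrow> \<exists>K i. kernel_of C X Y f K i"
    and ex_cokernel: "f \<in> Hom C X Y \<Longrightarrow> \<exists>Q p. cokernel_of C X Y f Q p"
    and mono_kernel: "mono_mor C X Y m \<Longrightarrow> \<exists>Z f. kernel_of C Y Z f X m"
    and epi_cokernel: "epi_mor C X Y e \<Longrightarrow> \<exists>W f. cokernel_of C W X f Y e"


section \<open>Fusion categories\<close>

locale monoidal_linear_category = linear_category +
  assumes tensm_closed: "f \<in> Hom C X Y \<Longrightarrow> g \<in> Hom C X' Y' \<Longrightarrow>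
      f \<star> g \<in> Hom C (X \<boxtimes> X') (Y \<boxtimes> Y')"
    and tensm_Id: "Id X \<star> Id Y = Id (X \<boxtimes> Y)"
    and tensm_Comp: "f \<in> Hom C X Y \<Longrightarrow> g \<in> Hom C Y Z \<Longrightarrow> f' \<in> Hom C X' Y' \<Longrightarrow> g' \<in> Hom C Y' Z' \<Longrightarrow>
      (g \<cdot> f) \<star> (g' \<cdot> f') = (g \<star> g') \<cdot> (f \<star> f')"
    and tensm_add_left: "f \<in> Hom C X Y \<Longrightarrow> f' \<in> Hom C X Y \<Longrightarrow> g \<in> Hom C X' Y' \<Longrightarrow>
      (f + f') \<star> g = f \<star> g + f' \<star> g"
    and tensm_add_right: "f \<in> Hom C X Y \<Longrightarrow> g \<in> Hom C X' Y' \<Longrightarrow> g' \<in> Hom C X' Y' \<Longrightarrow>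
      f \<star> (g + g') = f \<star> g + f \<star> g'"
    and tensm_scale_left: "f \<in> Hom C X Y \<Longrightarrow> g \<in> Hom C X' Y' \<Longrightarrow>
      scale C c f \<star> g = scale C c (f \<star> g)"
    and tensm_scale_right: "f \<in> Hom C X Y \<Longrightarrow> g \<in> Hom C X' Y' \<Longrightarrow>
      f \<star> scale C c g = scale C c (f \<star> g)"
    and assoc_iso: "iso_mor C ((X \<boxtimes> Y) \<boxtimes> Z) (X \<boxtimes> (Y \<boxtimes> Z)) (assoc C X Y Z)"
    and lunit_iso: "iso_mor C (unit_obj C \<boxtimes> X) X (lunit C X)"
    and runit_iso: "iso_mor C (X \<boxtimes> unit_obj C) X (runit C X)"
    and assoc_natural: "f \<in> Hom C X X' \<Longrightarrow> g \<in> Hom C Y Y' \<Longrightarrow> h \<in> Hom C Z Z' \<Longrightarrow>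
      assoc C X' Y' Z' \<cdot> ((f \<star> g) \<star> h) = (f \<star> (g \<star> h)) \<cdot> assoc C X Y Z"
    and lunit_natural: "f \<in> Hom C X Y \<Longrightarrow> lunit C Y \<cdot> (Id (unit_obj C) \<star> f) = f \<cdot> lunit C X"
    and runit_natural: "f \<in> Hom C X Y \<Longrightarrow> runit C Y \<cdot> (f \<star> Id (unit_obj C)) = f \<cdot> runit C X"
    and pentagon: "assoc C W X (Y \<boxtimes> Z) \<cdot> assoc C (W \<boxtimes> X) Y Z =
      (Id W \<star> assoc C X Y Z) \<cdot> assoc C W (X \<boxtimes> Y) Z \<cdot> (assoc C W X Y \<star> Id Z)"
    and triangle: "(Id X \<star> lunit C Y) \<cdot> assoc C X (unit_obj C) Y = runit C X \<star> Id Y"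

text \<open>
  \<open>V\<close> is a left dual of \<open>X\<close>, with evaluation \<open>ev : V \<otimes> X \<rightarrow> 1\<close> and coevaluation
  \<open>coev : 1 \<rightarrow> X \<otimes> V\<close>; equivalently, \<open>X\<close> is a right dual of \<open>V\<close>.
\<close>

definition left_dual :: "('o, 'm, 'k) tensor_data \<Rightarrow> 'o \<Rightarrow> 'o \<Rightarrow> bool" where
  "left_dual C X V \<longleftrightarrow>
     (\<exists>ev coev a.
        ev \<in> Hom C (V \<boxtimes>\<^bsub>C\<^esub> X) (unit_obj C) \<and> coev \<in> Hom C (unit_obj C) (X \<boxtimes>\<^bsub>C\<^esub> V) \<and>
        inverse_mor C ((V \<boxtimes>\<^bsub>C\<^esub> X) \<boxtimes>\<^bsub>C\<^esub> V) (V \<boxtimes>\<^bsub>C\<^esub> (X \<boxtimes>\<^bsub>C\<^esub> V)) (assoc C V X V) a \<and>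
        runit C X \<cdot>\<^bsub>C\<^esub> (Id\<^bsub>C\<^esub> X \<star>\<^bsub>C\<^esub> ev) \<cdot>\<^bsub>C\<^esub> assoc C X V X \<cdot>\<^bsub>C\<^esub> (coev \<star>\<^bsub>C\<^esub> Id\<^bsub>C\<^esub> X) = lunit C X \<and>
        lunit C V \<cdot>\<^bsub>C\<^esub> (ev \<star>\<^bsub>C\<^esub> Id\<^bsub>C\<^esub> V) \<cdot>\<^bsub>C\<^esub> a \<cdot>\<^bsub>C\<^esub> (Id\<^bsub>C\<^esub> V \<star>\<^bsub>C\<^esub> coev) = runit C V)"

text \<open>Left duals are unique up to isomorphism; \<open>dual C X\<close> is the object \<open>X\<^sup>*\<close>.\<close>

definition dual :: "('o, 'm, 'k) tensor_data \<Rightarrow> 'o \<Rightarrow> 'o" where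
  "dual C X = (SOME V. left_dual C X V)"

locale fusion_category = abelian_linear_category C + monoidal_linear_category C
  for C :: "('o, 'm::ab_group_add, 'k::{alg_closed_field, field_char_0}) tensor_data" (structure) +
  assumes finite_dim_Hom: "\<exists>B. finite B \<and> Hom C X Y \<subseteq> span B"
    and semisimple: "\<exists>(I :: nat set) F. (\<forall>i\<in>I. simple_obj C (F i)) \<and> is_direct_sum C I F X"
    and finite_Irr: "finite (Irr C UNIV)"
    and simple_unit: "simple_obj C (unit_obj C)"
    and ex_left_dual: "\<exists>V. left_dual C X V"
    and ex_right_dual: "\<exists>V. left_dual C V X"

definition invertible_obj :: "('o, 'm, 'k) tensor_data \<Rightarrow> 'o \<Rightarrow> bool" where
  "invertible_obj C X \<longleftrightarrow>
     (\<exists>Y. isomorphic C (X \<boxtimes>\<^bsub>C\<^esub> Y) (unit_obj C) \<and> isomorphic C (Y \<boxtimes>\<^bsub>C\<^esub> X) (unit_obj C))"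

text \<open>The tensor product of isomorphism classes: \<open>[X] [Y] = [X \<otimes> Y]\<close>.\<close>

definition class_tens :: "('o, 'm, 'k) tensor_data \<Rightarrow> 'o set \<Rightarrow> 'o set \<Rightarrow> 'o set" where
  "class_tens C A B = {Z. \<exists>X\<in>A. \<exists>Y\<in>B. isomorphic C (X \<boxtimes>\<^bsub>C\<^esub> Y) Z}"

definition inv_group :: "('o, 'm::zero, 'k) tensor_data \<Rightarrow> 'o set monoid" where
  "inv_group C =
     \<lparr>carrier = {iso_class C X | X. simple_obj C X \<and> invertible_obj C X},
      monoid.mult = class_tens C, one = iso_class C (unit_obj C)\<rparr>"


section \<open>Fusion subcategories and gradings\<close>

text \<open>Both closure conditions include closure under isomorphism.\<close>

definition additive_subcat :: "('o, 'm::ab_group_add, 'k) tensor_data \<Rightarrow> 'o set \<Rightarrow> bool" where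
  "additive_subcat C S \<longleftrightarrow>
     (\<forall>(I :: nat set) F Z. (\<forall>i\<in>I. F i \<in> S) \<longrightarrow> is_direct_sum C I F Z \<longrightarrow> Z \<in> S) \<and>
     (\<forall>Y Z. Z \<in> S \<longrightarrow> is_summand C Y Z \<longrightarrow> Y \<in> S)"

definition fusion_subcat :: "('o, 'm::ab_group_add, 'k) tensor_data \<Rightarrow> 'o set \<Rightarrow> bool" where
  "fusion_subcat C S \<longleftrightarrow> additive_subcat C S \<and> unit_obj C \<in> S \<and>
     (\<forall>X\<in>S. \<forall>Y\<in>S. X \<boxtimes>\<^bsub>C\<^esub> Y \<in> S) \<and> (\<forall>X\<in>S. \<forall>V. left_dual C X V \<or> left_dual C V X \<longrightarrow> V \<in> S)"

definition pointed :: "('o, 'm::zero, 'k) tensor_data \<Rightarrow> 'o set \<Rightarrow> bool" where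
  "pointed C S \<longleftrightarrow> (\<forall>X\<in>S. simple_obj C X \<longrightarrow> invertible_obj C X)"

definition generated_subcat :: "('o, 'm::ab_group_add, 'k) tensor_data \<Rightarrow> 'o set \<Rightarrow> 'o set" where
  "generated_subcat C T = \<Inter>{S. fusion_subcat C S \<and> T \<subseteq> S}"

definition adjoint_subcat :: "('o, 'm::ab_group_add, 'k) tensor_data \<Rightarrow> 'o set" where
  "adjoint_subcat C =
     generated_subcat C
       {Y. simple_obj C Y \<and> (\<exists>X. simple_obj C X \<and> is_summand C Y (X \<boxtimes>\<^bsub>C\<^esub> dual C X))}"

text \<open>\<open>component_sum C D H\<close> is the full subcategory \<open>\<Oplus>\<^bsub>h\<in>H\<^esub> D h\<close>.\<close>

definition component_sum ::
  "('o, 'm::ab_group_add, 'k) tensor_data \<Rightarrow> ('u \<Rightarrow> 'o set) \<Rightarrow> 'u set \<Rightarrow> 'o set" where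
  "component_sum C D H = {X. \<exists>I F. I \<subseteq> H \<and> (\<forall>g\<in>I. F g \<in> D g) \<and> is_direct_sum C I F X}"

definition grading ::
  "('o, 'm::ab_group_add, 'k) tensor_data \<Rightarrow> 'u monoid \<Rightarrow> ('u \<Rightarrow> 'o set) \<Rightarrow> bool" where
  "grading C U D \<longleftrightarrow> group U \<and>
     (\<forall>g\<in>carrier U. additive_subcat C (D g)) \<and>
     (\<forall>g\<in>carrier U. \<forall>h\<in>carrier U. g \<noteq> h \<longrightarrow> (\<forall>X\<in>D g. \<forall>Y\<in>D h. Hom C X Y = {0})) \<and>
     component_sum C D (carrier U) = UNIV \<and>
     (\<forall>g\<in>carrier U. \<forall>h\<in>carrier U. \<forall>X\<in>D g. \<forall>Y\<in>D h. X \<boxtimes>\<^bsub>C\<^esub> Y \<in> D (g \<otimes>\<^bsub>U\<^esub> h))"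

definition faithful_grading ::
  "('o, 'm::ab_group_add, 'k) tensor_data \<Rightarrow> 'u monoid \<Rightarrow> ('u \<Rightarrow> 'o set) \<Rightarrow> bool" where
  "faithful_grading C U D \<longleftrightarrow> grading C U D \<and> (\<forall>g\<in>carrier U. \<exists>X\<in>D g. \<not> zero_obj C X)"

text \<open>
  The universal grading group and the universal grading are determined, up to isomorphism of
  the grading group, as the faithful grading whose trivial component is the adjoint subcategory.
\<close>

definition universal_grading ::
  "('o, 'm::ab_group_add, 'k) tensor_data \<Rightarrow> 'u monoid \<Rightarrow> ('u \<Rightarrow> 'o set) \<Rightarrow> bool" where
  "universal_grading C U D \<longleftrightarrow> faithful_grading C U D \<and> D \<one>\<^bsub>U\<^esub> = adjoint_subcat C"


section \<open>Generalized near-group fusion categories\<close>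

definition generalized_near_group ::
  "('o, 'm::ab_group_add, 'k::{alg_closed_field, field_char_0}) tensor_data \<Rightarrow> bool" where
  "generalized_near_group C \<longleftrightarrow> fusion_category C \<and> \<not> pointed C UNIV \<and>
     (\<forall>A \<in> Irr C UNIV - carrier (inv_group C).
        orbit (inv_group C) (class_tens C) A = Irr C UNIV - carrier (inv_group C))"

text \<open>
  The right-hand side \<open>\<Oplus>\<^bsub>h\<in>\<Gamma>\<^esub> h \<oplus> k\<^sub>1 X\<^sub>1 \<oplus> \<dots> \<oplus> k\<^sub>n X\<^sub>n\<close> is indexed by the
  disjoint union of \<open>\<Gamma>\<close> and the pairs \<open>(i, j)\<close> with \<open>1 \<le> i \<le> n\<close> and \<open>j < k i\<close>.
\<close>

definition near_group_type ::
  "('o, 'm::ab_group_add, 'k) tensor_data \<Rightarrow>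
     'o set monoid \<Rightarrow> 'o set set \<Rightarrow> nat \<Rightarrow> (nat \<Rightarrow> 'o) \<Rightarrow> (nat \<Rightarrow> nat) \<Rightarrow> bool" where
  "near_group_type C G \<Gamma> n X k \<longleftrightarrow>
     G = inv_group C \<and>
     bij_betw (\<lambda>i. iso_class C (X i)) {1..n} (Irr C UNIV - carrier G) \<and>
     \<Gamma> = stabilizer G (class_tens C) (iso_class C (X 1)) \<and>
     is_direct_sum C (\<Gamma> <+> (SIGMA i:{1..n}. {..<k i})) (case_sum iso_rep (\<lambda>(i, j). X i))
       (X 1 \<boxtimes>\<^bsub>C\<^esub> dual C (X 1))"

end

theory Submission
  imports Defs
begin

text \<open>
  A non-pointed fusion subcategory \<open>S\<close> contains \<open>C\<^sub>a\<^sub>d\<close>: if \<open>Z \<in> S\<close> and \<open>X\<close> are simple and not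
  invertible, then \<open>X \<cong> Z \<otimes> \<delta>\<close> with \<open>\<delta>\<close> invertible, by transitivity applied to the duals, so
  \<open>X \<otimes> X\<^sup>* \<cong> Z \<otimes> Z\<^sup>*\<close> lies in \<open>S\<close>.  If moreover \<open>Z \<in> S\<close> is simple of degree \<open>g\<close>, each simple \<open>W\<close> of
  degree \<open>g\<close> is a summand of \<open>(W \<otimes> Z\<^sup>*) \<otimes> Z\<close>, where \<open>W \<otimes> Z\<^sup>* \<in> C\<^sub>a\<^sub>d \<subseteq> S\<close>; hence \<open>S\<close> is the sum of
  the components it meets.  A component containing a non-invertible \<open>Z \<cong> \<delta> \<otimes> Y\<close>, with \<open>Y\<close>
  non-invertible in \<open>C\<^sub>a\<^sub>d\<close>, contains the invertible object \<open>\<delta>\<close>.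
\<close>

section \<open>Linear categories\<close>

text \<open>Neither the simplicity of duals nor an isomorphism between left and right duals is
  established. Appeals to X^* are replaced by the condition that the unit object is a summand of
  \<open>X \<boxtimes> V\<close> for a suitable simple \<open>V\<close>. Passing between this
  condition and actual duals takes the injectivity of three transposition maps between hom spaces,
  each obtained by writing out a zigzag identity with its associators and unitors. By semisimplicity
  a single nonzero morphism from or to a simple object already produces a summand, so no
  multiplicities or dimensions are computed.

  The condition on (k_1, ..., k_n) enters through one object: if k_i is nonzero, then X_i is a
  non-invertible summand of X_1 \<otimes> X_1^*, so it lies in the adjoint subcategory, which is
  therefore non-pointed. This is also the source of the non-invertible object of degree one from
  which invertible objects of every degree are produced.\<close>

context linear_category
begin

lemma Hom_0: "0 \<in> Hom C X Y"
  and Hom_diff: "f \<in> Hom C X Y \<Longrightarrow> g \<in> Hom C X Y \<Longrightarrow> f - g \<in> Hom C X Y"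
  using subspace_Hom[of X Y] subspace_0 subspace_diff by blast+

lemma Hom_sum: "(\<And>i. i \<in> I \<Longrightarrow> f i \<in> Hom C X Y) \<Longrightarrow> (\<Sum>i\<in>I. f i) \<in> Hom C X Y"
  by (rule subspace_sum[OF subspace_Hom])

lemma Comp_0_left: "f \<in> Hom C X Y \<Longrightarrow> 0 \<cdot> f = 0"
  using Comp_scale_left[of f X Y 0 Y 0] Hom_0 by simp

lemma Comp_0_right: "f \<in> Hom C X Y \<Longrightarrow> f \<cdot> 0 = 0"
  using Comp_scale_right[of 0 X X f Y 0] Hom_0 by simp

lemma Comp_diff_left:
  assumes "f \<in> Hom C X Y" "g \<in> Hom C Y Z" "h \<in> Hom C Y Z"
  shows "(g - h) \<cdot> f = g \<cdot> f - h \<cdot> f"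
  using Comp_add_left[OF assms(1) Hom_diff[OF assms(2,3)] assms(3)] by (simp add: algebra_simps)

lemma Comp_diff_right:
  assumes "f \<in> Hom C Y Z" "g \<in> Hom C X Y" "h \<in> Hom C X Y"
  shows "f \<cdot> (g - h) = f \<cdot> g - f \<cdot> h"
  using Comp_add_right[OF Hom_diff[OF assms(2,3)] assms(3) assms(1)] by (simp add: algebra_simps)

lemma Comp_sum_left:
  assumes "f \<in> Hom C X Y" "\<And>i. i \<in> I \<Longrightarrow> g i \<in> Hom C Y Z"
  shows "(\<Sum>i\<in>I. g i) \<cdot> f = (\<Sum>i\<in>I. g i \<cdot> f)"
  using assms(2)
proof (induction I rule: infinite_finite_induct)
  case (insert i I)
  then show ?case
    using Comp_add_left[OF assms(1), of "g i" Z "\<Sum>i\<in>I. g i"] by (simp add: Hom_sum)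
qed (simp_all add: Comp_0_left[OF assms(1)])

lemma Comp_sum_right:
  assumes "f \<in> Hom C Y Z" "\<And>i. i \<in> I \<Longrightarrow> g i \<in> Hom C X Y"
  shows "f \<cdot> (\<Sum>i\<in>I. g i) = (\<Sum>i\<in>I. f \<cdot> g i)"
  using assms(2)
proof (induction I rule: infinite_finite_induct)
  case (insert i I)
  then show ?case
    using Comp_add_right[OF _ _ assms(1), of "g i" X "\<Sum>i\<in>I. g i"] by (simp add: Hom_sum)
qed (simp_all add: Comp_0_right[OF assms(1)])

lemma inverse_morD:
  assumes "inverse_mor C X Y f g"
  shows "f \<in> Hom C X Y" "g \<in> Hom C Y X" "g \<cdot> f = Id X" "f \<cdot> g = Id Y"
  using assms by (auto simp: inverse_mor_def)

lemma inverse_mor_sym: "inverse_mor C X Y f g \<Longrightarrow> inverse_mor C Y X g f"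
  by (auto simp: inverse_mor_def)

lemma iso_mor_closed: "iso_mor C X Y f \<Longrightarrow> f \<in> Hom C X Y"
  by (auto simp: inverse_mor_def iso_mor_def)

lemma inverse_mor_Comp:
  assumes "inverse_mor C X Y f f'" "inverse_mor C Y Z g g'"
  shows "inverse_mor C X Z (g \<cdot> f) (f' \<cdot> g')"
proof -
  note f = inverse_morD[OF assms(1)] and g = inverse_morD[OF assms(2)]
  have "(f' \<cdot> g') \<cdot> (g \<cdot> f) = f' \<cdot> ((g' \<cdot> g) \<cdot> f)"
    by (simp only: Comp_assoc[OF Comp_closed[OF f(1) g(1)] g(2) f(2)] Comp_assoc[OF f(1) g(1,2)])
  moreover have "(g \<cdot> f) \<cdot> (f' \<cdot> g') = g \<cdot> ((f \<cdot> f') \<cdot> g')"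
    by (simp only: Comp_assoc[OF Comp_closed[OF g(2) f(2)] f(1) g(1)] Comp_assoc[OF g(2) f(2,1)])
  ultimately show ?thesis
    using f g Comp_closed by (auto simp: inverse_mor_def Comp_Id_left)
qed

lemma isomorphic_refl: "isomorphic C X X"
  unfolding isomorphic_def iso_mor_def inverse_mor_def
  using Id_closed Comp_Id_left by blast

lemma isomorphic_sym: "isomorphic C X Y \<Longrightarrow> isomorphic C Y X"
  unfolding isomorphic_def iso_mor_def using inverse_mor_sym by blast

lemma isomorphic_trans: "isomorphic C X Y \<Longrightarrow> isomorphic C Y Z \<Longrightarrow> isomorphic C X Z"
  unfolding isomorphic_def iso_mor_def using inverse_mor_Comp by blast

lemma iso_mor_isomorphic: "iso_mor C X Y f \<Longrightarrow> isomorphic C X Y"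
  by (auto simp: isomorphic_def)

lemma iso_class_eq_iff: "iso_class C X = iso_class C Y \<longleftrightarrow> isomorphic C X Y"
  unfolding iso_class_def using isomorphic_refl isomorphic_sym isomorphic_trans by blast

lemma iso_cancel_left:
  assumes "iso_mor C Y Z g" "f \<in> Hom C X Y" "g \<cdot> f = 0"
  shows "f = 0"
proof -
  from assms(1) obtain g' where g: "inverse_mor C Y Z g g'" by (auto simp: iso_mor_def)
  note g = inverse_morD[OF this]
  have "f = g' \<cdot> (g \<cdot> f)" using Comp_assoc[OF assms(2) g(1,2)] g Comp_Id_left[OF assms(2)] by simp
  then show ?thesis using assms(3) Comp_0_right[OF g(2)] by simp
qed

lemma iso_cancel_right:
  assumes "iso_mor C X Y g" "f \<in> Hom C Y Z" "f \<cdot> g = 0"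
  shows "f = 0"
proof -
  from assms(1) obtain g' where g: "inverse_mor C X Y g g'" by (auto simp: iso_mor_def)
  note g = inverse_morD[OF this]
  have "f = (f \<cdot> g) \<cdot> g'" using Comp_assoc[OF g(2,1) assms(2)] g Comp_Id_right[OF assms(2)] by simp
  then show ?thesis using assms(3) Comp_0_left[OF g(2)] by simp
qed

lemma zero_obj_Hom_into: "zero_obj C Y \<Longrightarrow> f \<in> Hom C X Y \<Longrightarrow> f = 0"
  using Comp_Id_left[of f X Y] Comp_0_left[of f X Y] by (simp add: zero_obj_def)

lemma zero_obj_Hom_from: "zero_obj C X \<Longrightarrow> f \<in> Hom C X Y \<Longrightarrow> f = 0"
  using Comp_Id_right[of f X Y] Comp_0_right[of f X Y] by (simp add: zero_obj_def)

lemma split_mono: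
  assumes "i \<in> Hom C Y Z" "p \<in> Hom C Z Y" "p \<cdot> i = Id Y"
  shows "mono_mor C Y Z i"
  unfolding mono_mor_def
proof (intro conjI allI ballI impI assms(1))
  fix W u v assume *: "u \<in> Hom C W Y" "v \<in> Hom C W Y" "i \<cdot> u = i \<cdot> v"
  have "p \<cdot> (i \<cdot> u) = p \<cdot> (i \<cdot> v)" using *(3) by simp
  then show "u = v"
    using Comp_assoc[OF *(1) assms(1,2)] Comp_assoc[OF *(2) assms(1,2)] assms(3) *(1,2) Comp_Id_left
    by metis
qed

lemma mono_mor_iso_Comp:
  assumes "mono_mor C X Y m" "inverse_mor C Y Z f g"
  shows "mono_mor C X Z (f \<cdot> m)"
proof -
  note f = inverse_morD[OF assms(2)]
  have m: "m \<in> Hom C X Y" using assms(1) by (simp add: mono_mor_def)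
  have "m \<cdot> u = g \<cdot> ((f \<cdot> m) \<cdot> u)" if "u \<in> Hom C W X" for u W
    using that Comp_assoc[OF that m f(1)] Comp_assoc[OF Comp_closed[OF that m] f(1,2)] f(3)
      Comp_Id_left[OF Comp_closed[OF that m]] by simp
  then show ?thesis
    using assms(1) Comp_closed[OF m f(1)] unfolding mono_mor_def by metis
qed

lemma isomorphic_zero_obj:
  assumes "isomorphic C X Y" "zero_obj C X" shows "zero_obj C Y"
proof -
  obtain f g where f: "inverse_mor C X Y f g" using assms(1) by (auto simp: isomorphic_def iso_mor_def)
  note f = inverse_morD[OF this]
  have "f = 0" using zero_obj_Hom_from[OF assms(2) f(1)] .
  then show ?thesis using f(4) Comp_0_left[OF f(2)] by (simp add: zero_obj_def)
qed

lemma isomorphic_simple: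
  assumes "isomorphic C X Y" "simple_obj C X" shows "simple_obj C Y"
proof -
  obtain g f where f: "inverse_mor C X Y g f" using assms(1) by (auto simp: isomorphic_def iso_mor_def)
  note fD = inverse_morD[OF f]
  have "zero_obj C W \<or> iso_mor C W Y m" if m: "mono_mor C W Y m" for W m
  proof -
    have mH: "m \<in> Hom C W Y" using m by (simp add: mono_mor_def)
    have "zero_obj C W \<or> iso_mor C W X (f \<cdot> m)"
      using assms(2) mono_mor_iso_Comp[OF m inverse_mor_sym[OF f]] by (auto simp: simple_obj_def)
    moreover have "iso_mor C W Y m" if iso: "iso_mor C W X (f \<cdot> m)"
    proof -
      obtain w where "inverse_mor C W X (f \<cdot> m) w" using iso by (auto simp: iso_mor_def)
      then have "inverse_mor C W Y (g \<cdot> (f \<cdot> m)) (w \<cdot> f)" using inverse_mor_Comp f by blast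
      moreover have "g \<cdot> (f \<cdot> m) = m"
        using Comp_assoc[OF mH fD(2,1)] fD(4) Comp_Id_left[OF mH] by simp
      ultimately show ?thesis by (auto simp: iso_mor_def)
    qed
    ultimately show ?thesis by blast
  qed
  moreover have "\<not> zero_obj C Y"
    using assms isomorphic_zero_obj[OF isomorphic_sym[OF assms(1)]] by (auto simp: simple_obj_def)
  ultimately show ?thesis by (auto simp: simple_obj_def)
qed

lemma Irr_iso_class_iff:
  "iso_class C X \<in> Irr C UNIV \<longleftrightarrow> simple_obj C X"
proof
  assume "iso_class C X \<in> Irr C UNIV"
  then obtain Y where "isomorphic C X Y" "simple_obj C Y" by (auto simp: Irr_def iso_class_eq_iff)
  then show "simple_obj C X" using isomorphic_simple isomorphic_sym by blast
qed (auto simp: Irr_def)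

lemma isomorphic_is_summand: "isomorphic C Y Z \<Longrightarrow> is_summand C Y Z"
  unfolding isomorphic_def iso_mor_def inverse_mor_def is_summand_def by blast

lemma is_summand_trans:
  assumes "is_summand C X Y" "is_summand C Y Z" shows "is_summand C X Z"
proof -
  obtain i p j q where i: "i \<in> Hom C X Y" "p \<in> Hom C Y X" "p \<cdot> i = Id X"
    and j: "j \<in> Hom C Y Z" "q \<in> Hom C Z Y" "q \<cdot> j = Id Y"
    using assms unfolding is_summand_def by blast
  have "(p \<cdot> q) \<cdot> (j \<cdot> i) = p \<cdot> ((q \<cdot> j) \<cdot> i)"
    by (simp only: Comp_assoc[OF Comp_closed[OF i(1) j(1)] j(2) i(2)] Comp_assoc[OF i(1) j(1,2)])
  then have "(p \<cdot> q) \<cdot> (j \<cdot> i) = Id X" using i j Comp_Id_left by simp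
  then show ?thesis unfolding is_summand_def using i j Comp_closed by blast
qed

lemma direct_sum_is_summand:
  "is_direct_sum C I F Z \<Longrightarrow> i \<in> I \<Longrightarrow> is_summand C (F i) Z"
  unfolding is_direct_sum_def is_summand_def by fastforce

text \<open>Inserting \<open>Id Z\<close> as the sum of the idempotents
  \<open>\<iota> i \<cdot> \<pi> i\<close> shows that \<open>f\<close> vanishes once all its
  components \<open>\<pi> i \<cdot> f\<close> do.\<close>

lemma direct_sum_nonzero_into:
  assumes "is_direct_sum C I F Z" "f \<in> Hom C W Z" "f \<noteq> 0"
  obtains i g where "i \<in> I" "g \<in> Hom C W (F i)" "g \<noteq> 0"
proof -
  from assms(1) obtain \<iota> \<pi> where \<iota>: "\<And>i. i \<in> I \<Longrightarrow> \<iota> i \<in> Hom C (F i) Z"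
    and \<pi>: "\<And>i. i \<in> I \<Longrightarrow> \<pi> i \<in> Hom C Z (F i)" and sum: "(\<Sum>i\<in>I. \<iota> i \<cdot> \<pi> i) = Id Z"
    unfolding is_direct_sum_def by (elim conjE exE) blast
  have "f = (\<Sum>i\<in>I. \<iota> i \<cdot> \<pi> i) \<cdot> f" using sum assms(2) Comp_Id_left by simp
  also have "\<dots> = (\<Sum>i\<in>I. (\<iota> i \<cdot> \<pi> i) \<cdot> f)"
    using \<iota> \<pi> Comp_closed by (intro Comp_sum_left[OF assms(2)]) blast
  also have "\<dots> = (\<Sum>i\<in>I. \<iota> i \<cdot> (\<pi> i \<cdot> f))"
    by (intro sum.cong refl Comp_assoc[OF assms(2) \<pi> \<iota>])
  finally have "(\<Sum>i\<in>I. \<iota> i \<cdot> (\<pi> i \<cdot> f)) \<noteq> 0" using assms(3) by (rule subst)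
  then obtain i where i: "i \<in> I" "\<iota> i \<cdot> (\<pi> i \<cdot> f) \<noteq> 0" by (rule sum.not_neutral_contains_not_neutral)
  then have "\<pi> i \<cdot> f \<noteq> 0" using Comp_0_right[OF \<iota>[OF i(1)]] by auto
  then show ?thesis by (rule that[OF i(1) Comp_closed[OF assms(2) \<pi>[OF i(1)]]])
qed

lemma direct_sum_nonzero_from:
  assumes "is_direct_sum C I F Z" "f \<in> Hom C Z W" "f \<noteq> 0"
  obtains i g where "i \<in> I" "g \<in> Hom C (F i) W" "g \<noteq> 0"
proof -
  from assms(1) obtain \<iota> \<pi> where \<iota>: "\<And>i. i \<in> I \<Longrightarrow> \<iota> i \<in> Hom C (F i) Z"
    and \<pi>: "\<And>i. i \<in> I \<Longrightarrow> \<pi> i \<in> Hom C Z (F i)" and sum: "(\<Sum>i\<in>I. \<iota> i \<cdot> \<pi> i) = Id Z"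
    unfolding is_direct_sum_def by (elim conjE exE) blast
  have "f = f \<cdot> (\<Sum>i\<in>I. \<iota> i \<cdot> \<pi> i)" using sum assms(2) Comp_Id_right by simp
  also have "\<dots> = (\<Sum>i\<in>I. f \<cdot> (\<iota> i \<cdot> \<pi> i))"
    using \<iota> \<pi> Comp_closed by (intro Comp_sum_right[OF assms(2)]) blast
  also have "\<dots> = (\<Sum>i\<in>I. (f \<cdot> \<iota> i) \<cdot> \<pi> i)"
    by (intro sum.cong refl Comp_assoc[OF \<pi> \<iota> assms(2), symmetric])
  finally have "(\<Sum>i\<in>I. (f \<cdot> \<iota> i) \<cdot> \<pi> i) \<noteq> 0" using assms(3) by (rule subst)
  then obtain i where i: "i \<in> I" "(f \<cdot> \<iota> i) \<cdot> \<pi> i \<noteq> 0" by (rule sum.not_neutral_contains_not_neutral)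
  then have "f \<cdot> \<iota> i \<noteq> 0" using Comp_0_left[OF \<pi>[OF i(1)]] by auto
  then show ?thesis by (rule that[OF i(1) Comp_closed[OF \<iota>[OF i(1)] assms(2)]])
qed

lemma summand_mor_nonzero:
  assumes "i \<in> Hom C Y Z" "p \<in> Hom C Z Y" "p \<cdot> i = Id Y" "\<not> zero_obj C Y"
  shows "i \<noteq> 0" "p \<noteq> 0"
  using assms Comp_0_left Comp_0_right by (auto simp: zero_obj_def)

lemma simple_nonzero: "simple_obj C X \<Longrightarrow> \<not> zero_obj C X"
  by (simp add: simple_obj_def)

end

section \<open>Schur's lemma\<close>

context abelian_linear_category
begin

text \<open>The kernel of \<open>f\<close> is a subobject of the simple object \<open>X\<close>. If
  it were all of \<open>X\<close>, then \<open>f\<close> would vanish; so it is zero and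
  \<open>f\<close> is a monomorphism. Simplicity is phrased through monomorphisms, so its definition
  for \<open>Y\<close> finishes the proof.\<close>

lemma schur:
  assumes "simple_obj C X" "simple_obj C Y" "f \<in> Hom C X Y" "f \<noteq> 0"
  shows "iso_mor C X Y f"
proof -
  obtain K i where K: "kernel_of C X Y f K i" using ex_kernel[OF assms(3)] by blast
  then have i: "i \<in> Hom C K X" "f \<cdot> i = 0" by (auto simp: kernel_of_def)
  have uniq: "\<exists>!u. u \<in> Hom C W K \<and> i \<cdot> u = w" if "w \<in> Hom C W X" "f \<cdot> w = 0" for W w
    using K that by (auto simp: kernel_of_def)
  have "mono_mor C K X i"
    unfolding mono_mor_def
  proof (intro conjI allI ballI impI i(1))
    fix W u v assume *: "u \<in> Hom C W K" "v \<in> Hom C W K" "i \<cdot> u = i \<cdot> v"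
    have "f \<cdot> (i \<cdot> u) = 0" using Comp_assoc[OF *(1) i(1) assms(3)] i(2) Comp_0_left[OF *(1)] by simp
    then show "u = v" using uniq[OF Comp_closed[OF *(1) i(1)]] * by metis
  qed
  then consider "zero_obj C K" | "iso_mor C K X i" using assms(1) by (auto simp: simple_obj_def)
  then have "zero_obj C K"
    using iso_cancel_right[OF _ assms(3) i(2)] assms(4) by cases auto
  have "mono_mor C X Y f"
    unfolding mono_mor_def
  proof (intro conjI allI ballI impI assms(3))
    fix W u v assume *: "u \<in> Hom C W X" "v \<in> Hom C W X" "f \<cdot> u = f \<cdot> v"
    have "f \<cdot> (u - v) = 0" using Comp_diff_right[OF assms(3) *(1,2)] *(3) by simp
    then obtain w where w: "w \<in> Hom C W K" "i \<cdot> w = u - v" using uniq Hom_diff *(1,2) by blast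
    then have "u - v = 0" using zero_obj_Hom_into[OF \<open>zero_obj C K\<close> w(1)] Comp_0_right[OF i(1)] by auto
    then show "u = v" by simp
  qed
  then show ?thesis using assms(1,2) by (auto simp: simple_obj_def)
qed

lemma simple_nonzero_Hom_isomorphic:
  "simple_obj C X \<Longrightarrow> simple_obj C Y \<Longrightarrow> f \<in> Hom C X Y \<Longrightarrow> f \<noteq> 0 \<Longrightarrow> isomorphic C X Y"
  using schur iso_mor_isomorphic by blast

end

section \<open>Monoidal categories and duals\<close>

context linear_category
begin

text \<open>Pushes a commuting square past a tail \<open>t\<close>. A morphism does not determine
  its source and target, so associativity cannot be used for plain rewriting, and each use must
  supply the types of all arrows.\<close>

lemma Comp_exchange:
  assumes "p \<cdot> q = q' \<cdot> p'" "t \<in> Hom C W A" "q \<in> Hom C A B" "p \<in> Hom C B D"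
    "p' \<in> Hom C A B'" "q' \<in> Hom C B' D"
  shows "p \<cdot> (q \<cdot> t) = q' \<cdot> (p' \<cdot> t)"
  using assms(1) Comp_assoc[OF assms(2-4)] Comp_assoc[OF assms(2,5,6)] by simp

end

context monoidal_linear_category
begin

abbreviation one_object ("\<I>") where "\<I> \<equiv> unit_obj C"

lemma tensm_0_left: "g \<in> Hom C X Y \<Longrightarrow> 0 \<star> g = 0"
  using tensm_scale_left[OF Hom_0[of W W], of g X Y 0] by simp

lemma tensm_0_right: "f \<in> Hom C X Y \<Longrightarrow> f \<star> 0 = 0"
  using tensm_scale_right[OF _ Hom_0[of W W], of f X Y 0] by simp

lemma tensm_sum_left:
  assumes "g \<in> Hom C X' Y'" "\<And>i. i \<in> I \<Longrightarrow> f i \<in> Hom C X Y"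
  shows "(\<Sum>i\<in>I. f i) \<star> g = (\<Sum>i\<in>I. f i \<star> g)"
  using assms(2)
proof (induction I rule: infinite_finite_induct)
  case (insert i I)
  then show ?case
    using tensm_add_left[OF _ _ assms(1), of "f i" X Y "\<Sum>i\<in>I. f i"] by (simp add: Hom_sum)
qed (simp_all add: tensm_0_left[OF assms(1)])

lemma tensm_sum_right:
  assumes "f \<in> Hom C X Y" "\<And>i. i \<in> I \<Longrightarrow> g i \<in> Hom C X' Y'"
  shows "f \<star> (\<Sum>i\<in>I. g i) = (\<Sum>i\<in>I. f \<star> g i)"
  using assms(2)
proof (induction I rule: infinite_finite_induct)
  case (insert i I)
  then show ?case
    using tensm_add_right[OF assms(1), of "g i" X' Y' "\<Sum>i\<in>I. g i"] by (simp add: Hom_sum)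
qed (simp_all add: tensm_0_right[OF assms(1)])

lemma tensm_Id_left_closed: "f \<in> Hom C X Y \<Longrightarrow> Id W \<star> f \<in> Hom C (W \<boxtimes> X) (W \<boxtimes> Y)"
  and tensm_Id_right_closed: "f \<in> Hom C X Y \<Longrightarrow> f \<star> Id W \<in> Hom C (X \<boxtimes> W) (Y \<boxtimes> W)"
  by (simp_all add: tensm_closed Id_closed)

lemma Id_tensm_Comp:
  assumes "f \<in> Hom C X Y" "g \<in> Hom C Y Z"
  shows "Id W \<star> (g \<cdot> f) = (Id W \<star> g) \<cdot> (Id W \<star> f)"
  using tensm_Comp[OF Id_closed[of W] Id_closed assms] Comp_Id_left[OF Id_closed] by simp

lemma tensm_Id_Comp:
  assumes "f \<in> Hom C X Y" "g \<in> Hom C Y Z"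
  shows "(g \<cdot> f) \<star> Id W = (g \<star> Id W) \<cdot> (f \<star> Id W)"
  using tensm_Comp[OF assms Id_closed[of W] Id_closed] Comp_Id_left[OF Id_closed] by simp

text \<open>Both sides equal \<open>f \<star> g\<close>.\<close>

lemma tensm_interchange:
  assumes "f \<in> Hom C X Y" "g \<in> Hom C X' Y'"
  shows "(f \<star> Id Y') \<cdot> (Id X \<star> g) = (Id Y \<star> g) \<cdot> (f \<star> Id X')"
  using tensm_Comp[OF Id_closed assms(1) assms(2) Id_closed]
    tensm_Comp[OF assms(1) Id_closed Id_closed assms(2)] assms
  by (simp add: Comp_Id_left Comp_Id_right)

lemma inverse_mor_tensm:
  assumes "inverse_mor C X Y f f'" "inverse_mor C X' Y' g g'"
  shows "inverse_mor C (X \<boxtimes> X') (Y \<boxtimes> Y') (f \<star> g) (f' \<star> g')"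
proof -
  note f = inverse_morD[OF assms(1)] and g = inverse_morD[OF assms(2)]
  show ?thesis
    using tensm_closed[OF f(1) g(1)] tensm_closed[OF f(2) g(2)]
      tensm_Comp[OF f(1,2) g(1,2)] tensm_Comp[OF f(2,1) g(2,1)] f(3,4) g(3,4)
    by (simp add: inverse_mor_def tensm_Id)
qed

lemma inverse_mor_Id: "inverse_mor C X X (Id X) (Id X)"
  by (simp add: inverse_mor_def Id_closed Comp_Id_left[OF Id_closed])

lemma iso_mor_tensm_Id:
  assumes "iso_mor C X Y f"
  shows "iso_mor C (X \<boxtimes> W) (Y \<boxtimes> W) (f \<star> Id W)" "iso_mor C (W \<boxtimes> X) (W \<boxtimes> Y) (Id W \<star> f)"
  using assms inverse_mor_tensm inverse_mor_Id unfolding iso_mor_def by blast+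

lemma isomorphic_tens:
  "isomorphic C X X' \<Longrightarrow> isomorphic C Y Y' \<Longrightarrow> isomorphic C (X \<boxtimes> Y) (X' \<boxtimes> Y')"
  unfolding isomorphic_def iso_mor_def using inverse_mor_tensm by blast

lemma isomorphic_assoc: "isomorphic C ((X \<boxtimes> Y) \<boxtimes> Z) (X \<boxtimes> (Y \<boxtimes> Z))"
  and isomorphic_lunit: "isomorphic C (\<I> \<boxtimes> X) X"
  and isomorphic_runit: "isomorphic C (X \<boxtimes> \<I>) X"
  using assoc_iso lunit_iso runit_iso by (blast intro: iso_mor_isomorphic)+

lemma assoc_closed: "assoc C X Y Z \<in> Hom C ((X \<boxtimes> Y) \<boxtimes> Z) (X \<boxtimes> (Y \<boxtimes> Z))"
  and lunit_closed: "lunit C X \<in> Hom C (\<I> \<boxtimes> X) X"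
  and runit_closed: "runit C X \<in> Hom C (X \<boxtimes> \<I>) X"
  by (rule iso_mor_closed assoc_iso lunit_iso runit_iso)+

lemma is_summand_tens:
  assumes "is_summand C A X" "is_summand C B Y"
  shows "is_summand C (A \<boxtimes> B) (X \<boxtimes> Y)"
proof -
  obtain i p j q where i: "i \<in> Hom C A X" "p \<in> Hom C X A" "p \<cdot> i = Id A"
    and j: "j \<in> Hom C B Y" "q \<in> Hom C Y B" "q \<cdot> j = Id B"
    using assms unfolding is_summand_def by blast
  have "(p \<star> q) \<cdot> (i \<star> j) = Id (A \<boxtimes> B)"
    using tensm_Comp[OF i(1,2) j(1,2)] i(3) j(3) by (simp add: tensm_Id)
  then show ?thesis
    unfolding is_summand_def using tensm_closed[OF i(1) j(1)] tensm_closed[OF i(2) j(2)] by blast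
qed

lemma is_summand_refl: "is_summand C X X"
  using isomorphic_is_summand isomorphic_refl .

lemma class_tens_iso_class: "class_tens C (iso_class C X) (iso_class C Y) = iso_class C (X \<boxtimes> Y)"
proof (intro equalityI subsetI)
  fix Z assume "Z \<in> class_tens C (iso_class C X) (iso_class C Y)"
  then obtain X' Y' where "isomorphic C X X'" "isomorphic C Y Y'" "isomorphic C (X' \<boxtimes> Y') Z"
    by (auto simp: class_tens_def iso_class_def)
  then show "Z \<in> iso_class C (X \<boxtimes> Y)"
    using isomorphic_trans[OF isomorphic_tens] by (auto simp: iso_class_def)
qed (use isomorphic_refl in \<open>auto simp: class_tens_def iso_class_def\<close>)

lemma direct_sum_tens_right:
  assumes "is_direct_sum C I F X"
  shows "is_direct_sum C I (\<lambda>i. F i \<boxtimes> Y) (X \<boxtimes> Y)"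
proof -
  from assms obtain \<iota> \<pi> where fin: "finite I"
    and *: "\<forall>i\<in>I. \<iota> i \<in> Hom C (F i) X \<and> \<pi> i \<in> Hom C X (F i)"
    and orth: "\<forall>i\<in>I. \<forall>j\<in>I. \<pi> i \<cdot> \<iota> j = (if i = j then Id (F i) else 0)"
    and sum: "(\<Sum>i\<in>I. \<iota> i \<cdot> \<pi> i) = Id X"
    unfolding is_direct_sum_def by (elim conjE exE) blast
  have \<iota>: "i \<in> I \<Longrightarrow> \<iota> i \<in> Hom C (F i) X" and \<pi>: "i \<in> I \<Longrightarrow> \<pi> i \<in> Hom C X (F i)" for i
    using * by auto
  have "(\<pi> i \<star> Id Y) \<cdot> (\<iota> j \<star> Id Y) = (if i = j then Id (F i \<boxtimes> Y) else 0)"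
    if "i \<in> I" "j \<in> I" for i j
    using tensm_Id_Comp[OF \<iota>[OF that(2)] \<pi>[OF that(1)], of Y, symmetric] that orth
    by (auto simp: tensm_Id tensm_0_left[OF Id_closed])
  moreover have "(\<Sum>i\<in>I. (\<iota> i \<star> Id Y) \<cdot> (\<pi> i \<star> Id Y)) = Id (X \<boxtimes> Y)"
  proof -
    have "(\<Sum>i\<in>I. (\<iota> i \<star> Id Y) \<cdot> (\<pi> i \<star> Id Y)) = (\<Sum>i\<in>I. (\<iota> i \<cdot> \<pi> i) \<star> Id Y)"
      by (intro sum.cong refl tensm_Id_Comp[OF \<pi> \<iota>, symmetric])
    also have "\<dots> = (\<Sum>i\<in>I. \<iota> i \<cdot> \<pi> i) \<star> Id Y"
      using Comp_closed[OF \<pi> \<iota>] by (intro tensm_sum_left[OF Id_closed, symmetric]) blast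
    finally show ?thesis using sum by (simp add: tensm_Id)
  qed
  moreover have "\<iota> i \<star> Id Y \<in> Hom C (F i \<boxtimes> Y) (X \<boxtimes> Y)" "\<pi> i \<star> Id Y \<in> Hom C (X \<boxtimes> Y) (F i \<boxtimes> Y)"
    if "i \<in> I" for i
    using tensm_Id_right_closed \<iota>[OF that] \<pi>[OF that] by blast+
  ultimately show ?thesis
    unfolding is_direct_sum_def using fin
    by (intro conjI exI[of _ "\<lambda>i. \<iota> i \<star> Id Y"] exI[of _ "\<lambda>i. \<pi> i \<star> Id Y"]) auto
qed

lemma direct_sum_tens_left:
  assumes "is_direct_sum C I F X"
  shows "is_direct_sum C I (\<lambda>i. Y \<boxtimes> F i) (Y \<boxtimes> X)"
proof -
  from assms obtain \<iota> \<pi> where fin: "finite I"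
    and *: "\<forall>i\<in>I. \<iota> i \<in> Hom C (F i) X \<and> \<pi> i \<in> Hom C X (F i)"
    and orth: "\<forall>i\<in>I. \<forall>j\<in>I. \<pi> i \<cdot> \<iota> j = (if i = j then Id (F i) else 0)"
    and sum: "(\<Sum>i\<in>I. \<iota> i \<cdot> \<pi> i) = Id X"
    unfolding is_direct_sum_def by (elim conjE exE) blast
  have \<iota>: "i \<in> I \<Longrightarrow> \<iota> i \<in> Hom C (F i) X" and \<pi>: "i \<in> I \<Longrightarrow> \<pi> i \<in> Hom C X (F i)" for i
    using * by auto
  have "(Id Y \<star> \<pi> i) \<cdot> (Id Y \<star> \<iota> j) = (if i = j then Id (Y \<boxtimes> F i) else 0)"
    if "i \<in> I" "j \<in> I" for i j
    using Id_tensm_Comp[OF \<iota>[OF that(2)] \<pi>[OF that(1)], of Y, symmetric] that orth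
    by (auto simp: tensm_Id tensm_0_right[OF Id_closed])
  moreover have "(\<Sum>i\<in>I. (Id Y \<star> \<iota> i) \<cdot> (Id Y \<star> \<pi> i)) = Id (Y \<boxtimes> X)"
  proof -
    have "(\<Sum>i\<in>I. (Id Y \<star> \<iota> i) \<cdot> (Id Y \<star> \<pi> i)) = (\<Sum>i\<in>I. Id Y \<star> (\<iota> i \<cdot> \<pi> i))"
      by (intro sum.cong refl Id_tensm_Comp[OF \<pi> \<iota>, symmetric])
    also have "\<dots> = Id Y \<star> (\<Sum>i\<in>I. \<iota> i \<cdot> \<pi> i)"
      using Comp_closed[OF \<pi> \<iota>] by (intro tensm_sum_right[OF Id_closed, symmetric]) blast
    finally show ?thesis using sum by (simp add: tensm_Id)
  qed
  moreover have "Id Y \<star> \<iota> i \<in> Hom C (Y \<boxtimes> F i) (Y \<boxtimes> X)" "Id Y \<star> \<pi> i \<in> Hom C (Y \<boxtimes> X) (Y \<boxtimes> F i)"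
    if "i \<in> I" for i
    using tensm_Id_left_closed \<iota>[OF that] \<pi>[OF that] by blast+
  ultimately show ?thesis
    unfolding is_direct_sum_def using fin
    by (intro conjI exI[of _ "\<lambda>i. Id Y \<star> \<iota> i"] exI[of _ "\<lambda>i. Id Y \<star> \<pi> i"]) auto
qed

section \<open>Faithfulness of tensoring with an invertible object\<close>

lemma unit_tensm_eq_0:
  assumes "u \<in> Hom C A B"
  shows "Id \<I> \<star> u = 0 \<Longrightarrow> u = 0" "u \<star> Id \<I> = 0 \<Longrightarrow> u = 0"
  using iso_cancel_right[OF lunit_iso assms] lunit_natural[OF assms] Comp_0_right[OF lunit_closed]
    iso_cancel_right[OF runit_iso assms] runit_natural[OF assms] Comp_0_right[OF runit_closed]
  by simp_all

lemma isomorphic_tensm_eq_0: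
  assumes "isomorphic C X Y" "u \<in> Hom C A B"
  shows "Id Y \<star> u = 0 \<Longrightarrow> Id X \<star> u = 0" "u \<star> Id Y = 0 \<Longrightarrow> u \<star> Id X = 0"
proof -
  obtain f where f: "iso_mor C X Y f" using assms(1) by (auto simp: isomorphic_def)
  note fH = iso_mor_closed[OF f]
  show "Id X \<star> u = 0" if "Id Y \<star> u = 0"
    using iso_cancel_left[OF iso_mor_tensm_Id(1)[OF f] tensm_Id_left_closed[OF assms(2)]]
      tensm_interchange[OF fH assms(2)] that Comp_0_left[OF tensm_Id_right_closed[OF fH]] by simp
  show "u \<star> Id X = 0" if "u \<star> Id Y = 0"
    using iso_cancel_left[OF iso_mor_tensm_Id(2)[OF f] tensm_Id_right_closed[OF assms(2)]]
      tensm_interchange[OF assms(2) fH] that Comp_0_left[OF tensm_Id_left_closed[OF fH]] by simp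
qed

text \<open>Tensoring once more with the inverse \<open>Y\<close> and rebracketing by naturality of
  the associator gives \<open>Id (Y \<boxtimes> X) \<star> u = 0\<close>. The isomorphism from
  \<open>Y \<boxtimes> X\<close> to the unit turns this into \<open>Id \<I> \<star> u = 0\<close>,
  and the left unitor removes the remaining factor.\<close>

lemma invertible_tensm_eq_0_left:
  assumes "invertible_obj C X" "u \<in> Hom C A B" "Id X \<star> u = 0"
  shows "u = 0"
proof -
  obtain Y where Y: "isomorphic C (Y \<boxtimes> X) \<I>" using assms(1) by (auto simp: invertible_obj_def)
  have "assoc C Y X B \<cdot> ((Id Y \<star> Id X) \<star> u) = (Id Y \<star> (Id X \<star> u)) \<cdot> assoc C Y X A"
    by (rule assoc_natural[OF Id_closed Id_closed assms(2)])
  then have "assoc C Y X B \<cdot> (Id (Y \<boxtimes> X) \<star> u) = 0"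
    using assms(3) by (simp add: tensm_Id tensm_0_right[OF Id_closed] Comp_0_left[OF assoc_closed])
  then have "Id (Y \<boxtimes> X) \<star> u = 0"
    using iso_cancel_left[OF assoc_iso tensm_Id_left_closed[OF assms(2)]] by blast
  then show ?thesis
    using isomorphic_tensm_eq_0(1)[OF isomorphic_sym[OF Y] assms(2)] unit_tensm_eq_0(1)[OF assms(2)]
    by blast
qed

lemma invertible_tensm_eq_0_right:
  assumes "invertible_obj C X" "u \<in> Hom C A B" "u \<star> Id X = 0"
  shows "u = 0"
proof -
  obtain Y where Y: "isomorphic C (X \<boxtimes> Y) \<I>" using assms(1) by (auto simp: invertible_obj_def)
  have "assoc C B X Y \<cdot> ((u \<star> Id X) \<star> Id Y) = (u \<star> (Id X \<star> Id Y)) \<cdot> assoc C A X Y"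
    by (rule assoc_natural[OF assms(2) Id_closed Id_closed])
  then have "(u \<star> Id (X \<boxtimes> Y)) \<cdot> assoc C A X Y = 0"
    using assms(3) by (simp add: tensm_Id tensm_0_left[OF Id_closed] Comp_0_right[OF assoc_closed])
  then have "u \<star> Id (X \<boxtimes> Y) = 0"
    using iso_cancel_right[OF assoc_iso tensm_Id_right_closed[OF assms(2)]] by blast
  then show ?thesis
    using isomorphic_tensm_eq_0(2)[OF isomorphic_sym[OF Y] assms(2)] unit_tensm_eq_0(2)[OF assms(2)]
    by blast
qed

lemma isomorphic_invertible:
  assumes "isomorphic C X Y" "invertible_obj C X" shows "invertible_obj C Y"
proof -
  obtain Z where "isomorphic C (X \<boxtimes> Z) \<I>" "isomorphic C (Z \<boxtimes> X) \<I>"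
    using assms(2) by (auto simp: invertible_obj_def)
  then have "isomorphic C (Y \<boxtimes> Z) \<I>" "isomorphic C (Z \<boxtimes> Y) \<I>"
    using isomorphic_trans isomorphic_tens isomorphic_refl isomorphic_sym[OF assms(1)] by blast+
  then show ?thesis by (auto simp: invertible_obj_def)
qed

text \<open>A one-sided inverse of \<open>Y\<close> agrees with the two-sided inverse
  \<open>Z\<close>, since X \<cong> X \<otimes> (Y \<otimes> Z) \<cong> (X \<otimes> Y) \<otimes> Z
  \<cong> Z.\<close>

lemma invertible_if_tens_invertible:
  assumes "invertible_obj C Y" "isomorphic C (X \<boxtimes> Y) \<I>"
  shows "invertible_obj C X"
proof -
  obtain Z where Z: "isomorphic C (Y \<boxtimes> Z) \<I>" "isomorphic C (Z \<boxtimes> Y) \<I>"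
    using assms(1) by (auto simp: invertible_obj_def)
  have "isomorphic C (X \<boxtimes> (Y \<boxtimes> Z)) X"
    using isomorphic_trans[OF isomorphic_tens[OF isomorphic_refl Z(1)] isomorphic_runit] .
  moreover have "isomorphic C ((X \<boxtimes> Y) \<boxtimes> Z) Z"
    using isomorphic_trans[OF isomorphic_tens[OF assms(2) isomorphic_refl] isomorphic_lunit] .
  ultimately have "isomorphic C Z X"
    using isomorphic_assoc isomorphic_sym isomorphic_trans by blast
  moreover have "invertible_obj C Z" using Z by (auto simp: invertible_obj_def)
  ultimately show ?thesis by (rule isomorphic_invertible)
qed

section \<open>Transposition of morphisms along duals\<close>

lemma left_dual_nonzero_quotient:
  assumes "left_dual C X V" "\<pi> \<in> Hom C V Q" "\<pi> \<noteq> 0"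
  obtains f where "f \<in> Hom C \<I> (X \<boxtimes> Q)" "f \<noteq> 0"
proof -
  obtain ev coev a where ev: "ev \<in> Hom C (V \<boxtimes> X) \<I>" and coev: "coev \<in> Hom C \<I> (X \<boxtimes> V)"
    and a: "inverse_mor C ((V \<boxtimes> X) \<boxtimes> V) (V \<boxtimes> (X \<boxtimes> V)) (assoc C V X V) a"
    and zigzag: "lunit C V \<cdot> (ev \<star> Id V) \<cdot> a \<cdot> (Id V \<star> coev) = runit C V"
    using assms(1) unfolding left_dual_def by (elim exE conjE) blast
  note a = inverse_morD[OF a]
  note \<pi> = assms(2)
  \<comment> \<open>The transpose of \<open>\<pi>\<close>; the zigzag identity of \<open>V\<close>
    recovers \<open>\<pi>\<close> from it, so it cannot vanish.\<close>
  define f where "f = (Id X \<star> \<pi>) \<cdot> coev"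
  have f: "f \<in> Hom C \<I> (X \<boxtimes> Q)"
    unfolding f_def by (rule Comp_closed[OF coev tensm_Id_left_closed[OF \<pi>]])
  have "f \<noteq> 0"
  proof
    assume "f = 0"
    \<comment> \<open>The partial composites of the zigzag. Naturality moves \<open>\<pi>\<close>
      past one arrow at a time, so the vanishing of \<open>Id V \<star> f\<close> propagates along
      the chain until it reaches \<open>\<pi> \<cdot> runit C V\<close>.\<close>
    define t1 where "t1 = Id V \<star> coev"
    define t2 where "t2 = a \<cdot> t1"
    define t3 where "t3 = (ev \<star> Id V) \<cdot> t2"
    have t1: "t1 \<in> Hom C (V \<boxtimes> \<I>) (V \<boxtimes> (X \<boxtimes> V))"
      unfolding t1_def by (rule tensm_Id_left_closed[OF coev])
    have t2: "t2 \<in> Hom C (V \<boxtimes> \<I>) ((V \<boxtimes> X) \<boxtimes> V)" unfolding t2_def by (rule Comp_closed[OF t1 a(2)])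
    have t3: "t3 \<in> Hom C (V \<boxtimes> \<I>) (\<I> \<boxtimes> V)"
      unfolding t3_def by (rule Comp_closed[OF t2 tensm_Id_right_closed[OF ev]])
    have "(Id V \<star> (Id X \<star> \<pi>)) \<cdot> t1 = Id V \<star> f"
      unfolding t1_def f_def by (rule Id_tensm_Comp[OF coev tensm_Id_left_closed[OF \<pi>], symmetric])
    then have 1: "(Id V \<star> (Id X \<star> \<pi>)) \<cdot> t1 = 0"
      using \<open>f = 0\<close> tensm_0_right[OF Id_closed] by simp
    have "assoc C V X Q \<cdot> ((Id (V \<boxtimes> X) \<star> \<pi>) \<cdot> t2) = (Id V \<star> (Id X \<star> \<pi>)) \<cdot> (assoc C V X V \<cdot> t2)"
      using assoc_natural[OF Id_closed[of V] Id_closed[of X] \<pi>]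
      by (intro Comp_exchange[OF _ t2 tensm_Id_left_closed[OF \<pi>] assoc_closed assoc_closed
            tensm_Id_left_closed[OF tensm_Id_left_closed[OF \<pi>]]]) (simp add: tensm_Id)
    also have "assoc C V X V \<cdot> t2 = t1"
      unfolding t2_def using Comp_assoc[OF t1 a(2,1)] a(4) Comp_Id_left[OF t1] by simp
    finally have 2: "(Id (V \<boxtimes> X) \<star> \<pi>) \<cdot> t2 = 0"
      using 1 iso_cancel_left[OF assoc_iso Comp_closed[OF t2 tensm_Id_left_closed[OF \<pi>]]] by simp
    have "(Id \<I> \<star> \<pi>) \<cdot> t3 = (ev \<star> Id Q) \<cdot> ((Id (V \<boxtimes> X) \<star> \<pi>) \<cdot> t2)"
      unfolding t3_def
      by (rule Comp_exchange[OF tensm_interchange[OF ev \<pi>, symmetric] t2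
            tensm_Id_right_closed[OF ev] tensm_Id_left_closed[OF \<pi>]
            tensm_Id_left_closed[OF \<pi>] tensm_Id_right_closed[OF ev]])
    then have 3: "(Id \<I> \<star> \<pi>) \<cdot> t3 = 0"
      using 2 Comp_0_right[OF tensm_Id_right_closed[OF ev]] by simp
    have "\<pi> \<cdot> runit C V = \<pi> \<cdot> (lunit C V \<cdot> t3)"
      using zigzag by (simp add: t3_def t2_def t1_def)
    also have "\<dots> = lunit C Q \<cdot> ((Id \<I> \<star> \<pi>) \<cdot> t3)"
      by (rule Comp_exchange[OF lunit_natural[OF \<pi>, symmetric] t3 lunit_closed \<pi>
            tensm_Id_left_closed[OF \<pi>] lunit_closed])
    finally have "\<pi> \<cdot> runit C V = 0" using 3 Comp_0_right[OF lunit_closed] by simp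
    then show False using iso_cancel_right[OF runit_iso \<pi>] assms(3) by blast
  qed
  then show ?thesis using that f by blast
qed

text \<open>The mirror image. Here \<open>X\<close> is the left dual of \<open>V\<close>, so the
  zigzag identity of \<open>V\<close> is the one containing the associator itself rather than its
  inverse.\<close>

lemma right_dual_nonzero_quotient:
  assumes "left_dual C V X" "\<pi> \<in> Hom C V Q" "\<pi> \<noteq> 0"
  obtains f where "f \<in> Hom C \<I> (Q \<boxtimes> X)" "f \<noteq> 0"
proof -
  obtain ev coev where ev: "ev \<in> Hom C (X \<boxtimes> V) \<I>" and coev: "coev \<in> Hom C \<I> (V \<boxtimes> X)"
    and zigzag: "runit C V \<cdot> (Id V \<star> ev) \<cdot> assoc C V X V \<cdot> (coev \<star> Id V) = lunit C V"
    using assms(1) unfolding left_dual_def by (elim exE conjE) blast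
  note \<pi> = assms(2)
  define f where "f = (\<pi> \<star> Id X) \<cdot> coev"
  have f: "f \<in> Hom C \<I> (Q \<boxtimes> X)"
    unfolding f_def by (rule Comp_closed[OF coev tensm_Id_right_closed[OF \<pi>]])
  have "f \<noteq> 0"
  proof
    assume "f = 0"
    define t1 where "t1 = coev \<star> Id V"
    define t2 where "t2 = assoc C V X V \<cdot> t1"
    define t3 where "t3 = (Id V \<star> ev) \<cdot> t2"
    have t1: "t1 \<in> Hom C (\<I> \<boxtimes> V) ((V \<boxtimes> X) \<boxtimes> V)"
      unfolding t1_def by (rule tensm_Id_right_closed[OF coev])
    have t2: "t2 \<in> Hom C (\<I> \<boxtimes> V) (V \<boxtimes> (X \<boxtimes> V))"
      unfolding t2_def by (rule Comp_closed[OF t1 assoc_closed])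
    have t3: "t3 \<in> Hom C (\<I> \<boxtimes> V) (V \<boxtimes> \<I>)"
      unfolding t3_def by (rule Comp_closed[OF t2 tensm_Id_left_closed[OF ev]])
    have "((\<pi> \<star> Id X) \<star> Id V) \<cdot> t1 = f \<star> Id V"
      unfolding t1_def f_def by (rule tensm_Id_Comp[OF coev tensm_Id_right_closed[OF \<pi>], symmetric])
    then have 1: "((\<pi> \<star> Id X) \<star> Id V) \<cdot> t1 = 0"
      using \<open>f = 0\<close> tensm_0_left[OF Id_closed] by simp
    have "(\<pi> \<star> Id (X \<boxtimes> V)) \<cdot> t2 = assoc C Q X V \<cdot> (((\<pi> \<star> Id X) \<star> Id V) \<cdot> t1)"
      unfolding t2_def using assoc_natural[OF \<pi> Id_closed[of X] Id_closed[of V]]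
      by (intro Comp_exchange[OF _ t1 assoc_closed tensm_Id_right_closed[OF \<pi>]
            tensm_Id_right_closed[OF tensm_Id_right_closed[OF \<pi>]] assoc_closed])
        (simp add: tensm_Id)
    then have 2: "(\<pi> \<star> Id (X \<boxtimes> V)) \<cdot> t2 = 0" using 1 Comp_0_right[OF assoc_closed] by simp
    have "(\<pi> \<star> Id \<I>) \<cdot> t3 = (Id Q \<star> ev) \<cdot> ((\<pi> \<star> Id (X \<boxtimes> V)) \<cdot> t2)"
      unfolding t3_def
      by (rule Comp_exchange[OF tensm_interchange[OF \<pi> ev] t2
            tensm_Id_left_closed[OF ev] tensm_Id_right_closed[OF \<pi>]
            tensm_Id_right_closed[OF \<pi>] tensm_Id_left_closed[OF ev]])
    then have 3: "(\<pi> \<star> Id \<I>) \<cdot> t3 = 0"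
      using 2 Comp_0_right[OF tensm_Id_left_closed[OF ev]] by simp
    have "\<pi> \<cdot> lunit C V = \<pi> \<cdot> (runit C V \<cdot> t3)"
      using zigzag by (simp add: t3_def t2_def t1_def)
    also have "\<dots> = runit C Q \<cdot> ((\<pi> \<star> Id \<I>) \<cdot> t3)"
      by (rule Comp_exchange[OF runit_natural[OF \<pi>, symmetric] t3 runit_closed \<pi>
            tensm_Id_right_closed[OF \<pi>] runit_closed])
    finally have "\<pi> \<cdot> lunit C V = 0" using 3 Comp_0_right[OF runit_closed] by simp
    then show False using iso_cancel_right[OF lunit_iso \<pi>] assms(3) by blast
  qed
  then show ?thesis using that f by blast
qed

text \<open>
  Up to coherence the morphism constructed here is \<open>(A \<otimes> ev) \<circ> (f \<otimes> Z)\<close>.  If it vanished,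
  then tensoring it with \<open>V\<close>, precomposing with \<open>coev\<close> and using the zigzag identity of \<open>V\<close>
  would give \<open>f = 0\<close>.
\<close>

lemma left_dual_nonzero_transpose:
  assumes "left_dual C Z V" "f \<in> Hom C \<I> (A \<boxtimes> V)" "f \<noteq> 0"
  obtains h where "h \<in> Hom C Z A" "h \<noteq> 0"
proof -
  obtain ev coev a where ev: "ev \<in> Hom C (V \<boxtimes> Z) \<I>" and coev: "coev \<in> Hom C \<I> (Z \<boxtimes> V)"
    and a: "inverse_mor C ((V \<boxtimes> Z) \<boxtimes> V) (V \<boxtimes> (Z \<boxtimes> V)) (assoc C V Z V) a"
    and zigzag: "lunit C V \<cdot> (ev \<star> Id V) \<cdot> a \<cdot> (Id V \<star> coev) = runit C V"
    using assms(1) unfolding left_dual_def by (elim exE conjE) blast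
  note a = inverse_morD[OF a]
  obtain b where "inverse_mor C ((\<I> \<boxtimes> Z) \<boxtimes> V) (\<I> \<boxtimes> (Z \<boxtimes> V)) (assoc C \<I> Z V) b"
    using assoc_iso unfolding iso_mor_def by blast
  note b = inverse_morD[OF this]
  obtain l where "inverse_mor C (\<I> \<boxtimes> Z) Z (lunit C Z) l"
    using lunit_iso unfolding iso_mor_def by blast
  note l = inverse_morD[OF this]
  note f = assms(2)
  define k0 where "k0 = assoc C A V Z \<cdot> (f \<star> Id Z)"
  define k where "k = (Id A \<star> ev) \<cdot> k0"
  have k0: "k0 \<in> Hom C (\<I> \<boxtimes> Z) (A \<boxtimes> (V \<boxtimes> Z))"
    unfolding k0_def by (rule Comp_closed[OF tensm_Id_right_closed[OF f] assoc_closed])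
  have k: "k \<in> Hom C (\<I> \<boxtimes> Z) (A \<boxtimes> \<I>)"
    unfolding k_def by (rule Comp_closed[OF k0 tensm_Id_left_closed[OF ev]])
  have "k \<noteq> 0"
  proof
    assume "k = 0"
    \<comment> \<open>The chain \<open>s0\<close> to \<open>s4\<close> applies \<open>coev\<close>
      and then \<open>f\<close>, and rebrackets the result to
      \<open>A \<boxtimes> ((V \<boxtimes> Z) \<boxtimes> V)\<close>, where \<open>ev\<close> can
      act on either side of the associator. The pair \<open>w\<close>, \<open>x\<close> carries
      \<open>f\<close> alone to \<open>A \<boxtimes> (V \<boxtimes> \<I>)\<close>. The goal is
      \<open>(Id A \<star> runit C V) \<cdot> x = 0\<close>, which forces \<open>x\<close>, then
      \<open>w\<close>, then \<open>f\<close> to vanish.\<close>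
    define s0 where "s0 = Id \<I> \<star> coev"
    define s1 where "s1 = b \<cdot> s0"
    define s2 where "s2 = ((f \<star> Id Z) \<star> Id V) \<cdot> s1"
    define s3 where "s3 = (assoc C A V Z \<star> Id V) \<cdot> s2"
    define s4 where "s4 = assoc C A (V \<boxtimes> Z) V \<cdot> s3"
    define w where "w = f \<star> Id \<I>"
    define x where "x = assoc C A V \<I> \<cdot> w"
    have s0: "s0 \<in> Hom C (\<I> \<boxtimes> \<I>) (\<I> \<boxtimes> (Z \<boxtimes> V))"
      unfolding s0_def by (rule tensm_Id_left_closed[OF coev])
    have s1: "s1 \<in> Hom C (\<I> \<boxtimes> \<I>) ((\<I> \<boxtimes> Z) \<boxtimes> V)" unfolding s1_def by (rule Comp_closed[OF s0 b(2)])
    have s2: "s2 \<in> Hom C (\<I> \<boxtimes> \<I>) (((A \<boxtimes> V) \<boxtimes> Z) \<boxtimes> V)"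
      unfolding s2_def
      by (rule Comp_closed[OF s1 tensm_Id_right_closed[OF tensm_Id_right_closed[OF f]]])
    have s3: "s3 \<in> Hom C (\<I> \<boxtimes> \<I>) ((A \<boxtimes> (V \<boxtimes> Z)) \<boxtimes> V)"
      unfolding s3_def by (rule Comp_closed[OF s2 tensm_Id_right_closed[OF assoc_closed]])
    have s4: "s4 \<in> Hom C (\<I> \<boxtimes> \<I>) (A \<boxtimes> ((V \<boxtimes> Z) \<boxtimes> V))"
      unfolding s4_def by (rule Comp_closed[OF s3 assoc_closed])
    have w: "w \<in> Hom C (\<I> \<boxtimes> \<I>) ((A \<boxtimes> V) \<boxtimes> \<I>)"
      unfolding w_def by (rule tensm_Id_right_closed[OF f])
    have x: "x \<in> Hom C (\<I> \<boxtimes> \<I>) (A \<boxtimes> (V \<boxtimes> \<I>))"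
      unfolding x_def by (rule Comp_closed[OF w assoc_closed])
    have zig1: "a \<cdot> (Id V \<star> coev) \<in> Hom C (V \<boxtimes> \<I>) ((V \<boxtimes> Z) \<boxtimes> V)"
      by (rule Comp_closed[OF tensm_Id_left_closed[OF coev] a(2)])
    have zig2: "(ev \<star> Id V) \<cdot> a \<cdot> (Id V \<star> coev) \<in> Hom C (V \<boxtimes> \<I>) (\<I> \<boxtimes> V)"
      by (rule Comp_closed[OF zig1 tensm_Id_right_closed[OF ev]])

    have "assoc C (A \<boxtimes> V) Z V \<cdot> s2 = (f \<star> Id (Z \<boxtimes> V)) \<cdot> (assoc C \<I> Z V \<cdot> s1)"
      unfolding s2_def using assoc_natural[OF f Id_closed[of Z] Id_closed[of V]]
      by (intro Comp_exchange[OF _ s1 tensm_Id_right_closed[OF tensm_Id_right_closed[OF f]]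
            assoc_closed assoc_closed tensm_Id_right_closed[OF f]]) (simp add: tensm_Id)
    also have "assoc C \<I> Z V \<cdot> s1 = s0"
      unfolding s1_def using Comp_assoc[OF s0 b(2,1)] b(4) Comp_Id_left[OF s0] by simp
    also have "(f \<star> Id (Z \<boxtimes> V)) \<cdot> s0 = (Id (A \<boxtimes> V) \<star> coev) \<cdot> w"
      unfolding s0_def w_def by (rule tensm_interchange[OF f coev])
    finally have 1: "assoc C (A \<boxtimes> V) Z V \<cdot> s2 = (Id (A \<boxtimes> V) \<star> coev) \<cdot> w" .

    \<comment> \<open>The pentagon for \<open>A\<close>, \<open>V\<close>, \<open>Z\<close>,
      \<open>V\<close>: the left side runs along its path of three associators. On the path of two,
      \<open>coev\<close> can be moved past \<open>f\<close>, so that it is applied last.\<close>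
    have "(Id A \<star> assoc C V Z V) \<cdot> s4
        = ((Id A \<star> assoc C V Z V) \<cdot> (assoc C A (V \<boxtimes> Z) V \<cdot> (assoc C A V Z \<star> Id V))) \<cdot> s2"
      unfolding s4_def s3_def
      using Comp_assoc[OF s2 tensm_Id_right_closed[OF assoc_closed] assoc_closed]
        Comp_assoc[OF s2 Comp_closed[OF tensm_Id_right_closed[OF assoc_closed] assoc_closed]
          tensm_Id_left_closed[OF assoc_closed]]
      by simp
    also have "\<dots> = (assoc C A V (Z \<boxtimes> V) \<cdot> assoc C (A \<boxtimes> V) Z V) \<cdot> s2"
      using pentagon by simp
    also have "\<dots> = assoc C A V (Z \<boxtimes> V) \<cdot> ((Id (A \<boxtimes> V) \<star> coev) \<cdot> w)"
      using Comp_assoc[OF s2 assoc_closed assoc_closed] 1 by simp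
    also have "\<dots> = (Id A \<star> (Id V \<star> coev)) \<cdot> x"
      unfolding x_def using assoc_natural[OF Id_closed[of A] Id_closed[of V] coev]
      by (intro Comp_exchange[OF _ w tensm_Id_left_closed[OF coev] assoc_closed assoc_closed
            tensm_Id_left_closed[OF tensm_Id_left_closed[OF coev]]]) (simp add: tensm_Id)
    finally have 2: "(Id A \<star> assoc C V Z V) \<cdot> s4 = (Id A \<star> (Id V \<star> coev)) \<cdot> x" .

    have "s4 = (Id A \<star> (a \<cdot> assoc C V Z V)) \<cdot> s4"
      using a(3) Comp_Id_left[OF s4] by (simp add: tensm_Id)
    also have "\<dots> = (Id A \<star> a) \<cdot> ((Id A \<star> assoc C V Z V) \<cdot> s4)"
      using Id_tensm_Comp[OF a(1,2)]
        Comp_assoc[OF s4 tensm_Id_left_closed[OF a(1)] tensm_Id_left_closed[OF a(2)]] by simp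
    also have "\<dots> = (Id A \<star> (a \<cdot> (Id V \<star> coev))) \<cdot> x"
      using 2 Id_tensm_Comp[OF tensm_Id_left_closed[OF coev] a(2)]
        Comp_assoc[OF x tensm_Id_left_closed[OF tensm_Id_left_closed[OF coev]]
          tensm_Id_left_closed[OF a(2)]] by simp
    finally have 3: "s4 = (Id A \<star> (a \<cdot> (Id V \<star> coev))) \<cdot> x" .

    have 4: "(Id A \<star> (ev \<star> Id V)) \<cdot> s4 = (Id A \<star> ((ev \<star> Id V) \<cdot> a \<cdot> (Id V \<star> coev))) \<cdot> x"
      unfolding 3 using Id_tensm_Comp[OF zig1 tensm_Id_right_closed[OF ev]]
        Comp_assoc[OF x tensm_Id_left_closed[OF zig1]
          tensm_Id_left_closed[OF tensm_Id_right_closed[OF ev]]] by simp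
    have 5: "(Id A \<star> lunit C V) \<cdot> ((Id A \<star> (ev \<star> Id V)) \<cdot> s4) = (Id A \<star> runit C V) \<cdot> x"
      unfolding 4 using Id_tensm_Comp[OF zig2 lunit_closed] zigzag
        Comp_assoc[OF x tensm_Id_left_closed[OF zig2] tensm_Id_left_closed[OF lunit_closed]] by simp

    \<comment> \<open>The same composite is now evaluated before rebracketing. Since
      \<open>s3\<close> contains \<open>k0\<close>, applying \<open>ev\<close> produces the factor
      \<open>k\<close>, which is zero by assumption.\<close>
    have "((Id A \<star> ev) \<star> Id V) \<cdot> s3 = ((Id A \<star> ev) \<star> Id V) \<cdot> ((k0 \<star> Id V) \<cdot> s1)"
      unfolding s3_def s2_def k0_def
      using Comp_assoc[OF s1 tensm_Id_right_closed[OF tensm_Id_right_closed[OF f]]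
          tensm_Id_right_closed[OF assoc_closed]]
        tensm_Id_Comp[OF tensm_Id_right_closed[OF f] assoc_closed] by simp
    also have "\<dots> = (k \<star> Id V) \<cdot> s1"
      unfolding k_def using tensm_Id_Comp[OF k0 tensm_Id_left_closed[OF ev]]
        Comp_assoc[OF s1 tensm_Id_right_closed[OF k0]
          tensm_Id_right_closed[OF tensm_Id_left_closed[OF ev]]] by simp
    also have "\<dots> = 0" using \<open>k = 0\<close> tensm_0_left[OF Id_closed] Comp_0_left[OF s1] by simp
    finally have 6: "((Id A \<star> ev) \<star> Id V) \<cdot> s3 = 0" .
    have "(Id A \<star> (ev \<star> Id V)) \<cdot> s4 = assoc C A \<I> V \<cdot> (((Id A \<star> ev) \<star> Id V) \<cdot> s3)"
      unfolding s4_def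
      by (rule Comp_exchange[OF assoc_natural[OF Id_closed ev Id_closed, symmetric] s3 assoc_closed
            tensm_Id_left_closed[OF tensm_Id_right_closed[OF ev]]
            tensm_Id_right_closed[OF tensm_Id_left_closed[OF ev]] assoc_closed])
    then have "(Id A \<star> runit C V) \<cdot> x = 0"
      using 5 6 Comp_0_right[OF assoc_closed]
        Comp_0_right[OF tensm_Id_left_closed[OF lunit_closed[of V]], of A] by simp
    then have "x = 0" using iso_cancel_left[OF iso_mor_tensm_Id(2)[OF runit_iso] x] by blast
    then have "w = 0" using iso_cancel_left[OF assoc_iso w] by (simp add: x_def)
    then show False using unit_tensm_eq_0(2)[OF f] assms(3) by (simp add: w_def)
  qed
  then have "runit C A \<cdot> k \<noteq> 0" using iso_cancel_left[OF runit_iso k] by blast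
  moreover have rk: "runit C A \<cdot> k \<in> Hom C (\<I> \<boxtimes> Z) A" by (rule Comp_closed[OF k runit_closed])
  moreover have "iso_mor C Z (\<I> \<boxtimes> Z) l" using l by (auto simp: iso_mor_def inverse_mor_def)
  ultimately have "(runit C A \<cdot> k) \<cdot> l \<noteq> 0" using iso_cancel_right by blast
  then show ?thesis by (rule that[OF Comp_closed[OF l(2) rk]])
qed

end

section \<open>Semisimplicity\<close>

context fusion_category
begin

text \<open>Some component of \<open>f\<close> into a simple summand of \<open>X\<close> is nonzero,
  hence an isomorphism by Schur's lemma. The inclusion obtained is that of the summand and need not
  be \<open>f\<close>.\<close>

lemma simple_into_is_summand:
  assumes "simple_obj C Y" "f \<in> Hom C Y X" "f \<noteq> 0"
  shows "is_summand C Y X"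
proof -
  obtain I :: "nat set" and F where F: "\<forall>i\<in>I. simple_obj C (F i)" "is_direct_sum C I F X"
    using semisimple by blast
  obtain i g where "i \<in> I" "g \<in> Hom C Y (F i)" "g \<noteq> 0"
    using direct_sum_nonzero_into[OF F(2) assms(2,3)] by blast
  then have "i \<in> I" "isomorphic C Y (F i)"
    using F(1) simple_nonzero_Hom_isomorphic[OF assms(1)] by blast+
  then show ?thesis
    by (intro is_summand_trans[OF isomorphic_is_summand direct_sum_is_summand[OF F(2)]])
qed

lemma simple_from_is_summand:
  assumes "simple_obj C Y" "f \<in> Hom C X Y" "f \<noteq> 0"
  shows "is_summand C Y X"
proof -
  obtain I :: "nat set" and F where F: "\<forall>i\<in>I. simple_obj C (F i)" "is_direct_sum C I F X"
    using semisimple by blast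
  obtain i g where "i \<in> I" "g \<in> Hom C (F i) Y" "g \<noteq> 0"
    using direct_sum_nonzero_from[OF F(2) assms(2,3)] by blast
  then have "i \<in> I" "isomorphic C (F i) Y"
    using F(1) simple_nonzero_Hom_isomorphic[OF _ assms(1)] by blast+
  then show ?thesis
    by (intro is_summand_trans[OF isomorphic_is_summand[OF isomorphic_sym]
          direct_sum_is_summand[OF F(2)]])
qed

lemma simple_summandE:
  assumes "simple_obj C Y" "is_summand C Y X"
  obtains i p where "i \<in> Hom C Y X" "p \<in> Hom C X Y" "p \<cdot> i = Id Y" "i \<noteq> 0" "p \<noteq> 0"
proof -
  obtain i p where i: "i \<in> Hom C Y X" "p \<in> Hom C X Y" "p \<cdot> i = Id Y"
    using assms(2) unfolding is_summand_def by blast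
  show ?thesis by (rule that[OF i summand_mor_nonzero[OF i simple_nonzero[OF assms(1)]]])
qed

lemma ex_simple_summand:
  assumes "\<not> zero_obj C X"
  obtains Y where "simple_obj C Y" "is_summand C Y X"
proof -
  obtain I :: "nat set" and F where F: "\<forall>i\<in>I. simple_obj C (F i)" "is_direct_sum C I F X"
    using semisimple by blast
  have "Id X \<noteq> 0" using assms by (simp add: zero_obj_def)
  then obtain i where "i \<in> I" by (rule direct_sum_nonzero_into[OF F(2) Id_closed])
  then show ?thesis using F(1) direct_sum_is_summand[OF F(2)] that by blast
qed

lemma simple_summand_simple:
  assumes "simple_obj C X" "simple_obj C Y" "is_summand C X Y"
  shows "isomorphic C X Y"
  by (rule simple_summandE[OF assms(1,3)]) (rule simple_nonzero_Hom_isomorphic[OF assms(1,2)])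

lemma simple_summand_direct_sum:
  assumes "simple_obj C Q" "is_direct_sum C I F Z" "is_summand C Q Z"
  obtains i where "i \<in> I" "is_summand C Q (F i)"
proof -
  obtain j where j: "j \<in> Hom C Q Z" "j \<noteq> 0" using simple_summandE[OF assms(1,3)] by blast
  obtain i g where "i \<in> I" "g \<in> Hom C Q (F i)" "g \<noteq> 0"
    using direct_sum_nonzero_into[OF assms(2) j] by blast
  then show ?thesis using that simple_into_is_summand[OF assms(1)] by blast
qed

text \<open>The tensor product distributes over decompositions of \<open>X\<close> and
  \<open>Y\<close> into simple objects, and \<open>Q\<close> must occur in one of the terms. This
  reduces questions about products in a subcategory to products of simple objects.\<close>

lemma simple_summand_tens:
  assumes "simple_obj C Q" "is_summand C Q (X \<boxtimes> Y)"
  obtains A B where "simple_obj C A" "is_summand C A X" "simple_obj C B" "is_summand C B Y"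
    "is_summand C Q (A \<boxtimes> B)"
proof -
  obtain I :: "nat set" and F where F: "\<forall>i\<in>I. simple_obj C (F i)" "is_direct_sum C I F X"
    using semisimple by blast
  obtain J :: "nat set" and G where G: "\<forall>j\<in>J. simple_obj C (G j)" "is_direct_sum C J G Y"
    using semisimple by blast
  obtain i where i: "i \<in> I" "is_summand C Q (F i \<boxtimes> Y)"
    using simple_summand_direct_sum[OF assms(1) direct_sum_tens_right[OF F(2)] assms(2)] by blast
  obtain j where j: "j \<in> J" "is_summand C Q (F i \<boxtimes> G j)"
    using simple_summand_direct_sum[OF assms(1) direct_sum_tens_left[OF G(2)] i(2)] by blast
  show ?thesis
    using that[OF _ direct_sum_is_summand[OF F(2) i(1)] _ direct_sum_is_summand[OF G(2) j(1)] j(2)]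
      F(1) G(1) i(1) j(1) by blast
qed

section \<open>Tensoring with an invertible object preserves simplicity\<close>

lemma invertible_tens_zero_obj:
  assumes "invertible_obj C D"
  shows "zero_obj C (D \<boxtimes> X) \<Longrightarrow> zero_obj C X" "zero_obj C (X \<boxtimes> D) \<Longrightarrow> zero_obj C X"
  unfolding zero_obj_def tensm_Id[symmetric]
  using invertible_tensm_eq_0_left[OF assms Id_closed] invertible_tensm_eq_0_right[OF assms Id_closed]
  by blast+

text \<open>
  A simple summand \<open>Y\<close> of \<open>D \<otimes> X\<close> has idempotent \<open>i \<circ> p\<close>.  Tensored with the inverse of \<open>D\<close>
  this becomes the identity, because \<open>X\<close> has no proper summand; hence \<open>Y\<close> is all of
  \<open>D \<otimes> X\<close>.
\<close>

lemma simple_tens_left: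
  assumes "invertible_obj C D" "simple_obj C X"
  shows "simple_obj C (D \<boxtimes> X)"
proof -
  obtain E where E: "isomorphic C (D \<boxtimes> E) \<I>" "isomorphic C (E \<boxtimes> D) \<I>"
    using assms(1) by (auto simp: invertible_obj_def)
  then have invE: "invertible_obj C E" by (auto simp: invertible_obj_def)
  obtain Y where Y: "simple_obj C Y" "is_summand C Y (D \<boxtimes> X)"
    using ex_simple_summand invertible_tens_zero_obj(1)[OF assms(1)] simple_nonzero[OF assms(2)]
    by blast
  obtain i p where i: "i \<in> Hom C Y (D \<boxtimes> X)" "p \<in> Hom C (D \<boxtimes> X) Y" "p \<cdot> i = Id Y"
    using simple_summandE[OF Y] by blast
  have ex: "isomorphic C (E \<boxtimes> (D \<boxtimes> X)) X"
    using isomorphic_trans[OF isomorphic_sym[OF isomorphic_assoc]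
        isomorphic_trans[OF isomorphic_tens[OF E(2) isomorphic_refl] isomorphic_lunit]] .
  have simp: "simple_obj C (E \<boxtimes> (D \<boxtimes> X))"
    by (rule isomorphic_simple[OF isomorphic_sym[OF ex] assms(2)])
  have pi: "(Id E \<star> p) \<cdot> (Id E \<star> i) = Id (E \<boxtimes> Y)"
    using Id_tensm_Comp[OF i(1,2), of E] i(3) by (simp add: tensm_Id)
  have "mono_mor C (E \<boxtimes> Y) (E \<boxtimes> (D \<boxtimes> X)) (Id E \<star> i)"
    by (rule split_mono[OF tensm_Id_left_closed[OF i(1)] tensm_Id_left_closed[OF i(2)] pi])
  moreover have "\<not> zero_obj C (E \<boxtimes> Y)"
    using invertible_tens_zero_obj(1)[OF invE] simple_nonzero[OF Y(1)] by blast
  ultimately have iso: "iso_mor C (E \<boxtimes> Y) (E \<boxtimes> (D \<boxtimes> X)) (Id E \<star> i)"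
    using simp by (auto simp: simple_obj_def)
  have ip: "i \<cdot> p \<in> Hom C (D \<boxtimes> X) (D \<boxtimes> X)" by (rule Comp_closed[OF i(2,1)])
  have d: "i \<cdot> p - Id (D \<boxtimes> X) \<in> Hom C (D \<boxtimes> X) (D \<boxtimes> X)"
    by (rule Hom_diff[OF ip Id_closed])
  have "(i \<cdot> p - Id (D \<boxtimes> X)) \<cdot> i = 0"
    using Comp_diff_left[OF i(1) ip Id_closed] Comp_assoc[OF i(1,2,1)] i(3)
      Comp_Id_left[OF i(1)] Comp_Id_right[OF i(1)] by simp
  then have "(Id E \<star> (i \<cdot> p - Id (D \<boxtimes> X))) \<cdot> (Id E \<star> i) = 0"
    using Id_tensm_Comp[OF i(1) d, of E] tensm_0_right[OF Id_closed] by simp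
  then have "Id E \<star> (i \<cdot> p - Id (D \<boxtimes> X)) = 0"
    using iso_cancel_right[OF iso tensm_Id_left_closed[OF d]] by blast
  then have "i \<cdot> p = Id (D \<boxtimes> X)"
    using invertible_tensm_eq_0_left[OF invE d] by simp
  then have "isomorphic C Y (D \<boxtimes> X)"
    using i by (auto simp: isomorphic_def iso_mor_def inverse_mor_def)
  then show ?thesis using isomorphic_simple Y(1) by blast
qed

lemma simple_tens_right:
  assumes "invertible_obj C D" "simple_obj C X"
  shows "simple_obj C (X \<boxtimes> D)"
proof -
  obtain E where E: "isomorphic C (D \<boxtimes> E) \<I>" "isomorphic C (E \<boxtimes> D) \<I>"
    using assms(1) by (auto simp: invertible_obj_def)
  then have invE: "invertible_obj C E" by (auto simp: invertible_obj_def)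
  obtain Y where Y: "simple_obj C Y" "is_summand C Y (X \<boxtimes> D)"
    using ex_simple_summand invertible_tens_zero_obj(2)[OF assms(1)] simple_nonzero[OF assms(2)]
    by blast
  obtain i p where i: "i \<in> Hom C Y (X \<boxtimes> D)" "p \<in> Hom C (X \<boxtimes> D) Y" "p \<cdot> i = Id Y"
    using simple_summandE[OF Y] by blast
  have ex: "isomorphic C ((X \<boxtimes> D) \<boxtimes> E) X"
    using isomorphic_trans[OF isomorphic_assoc
        isomorphic_trans[OF isomorphic_tens[OF isomorphic_refl E(1)] isomorphic_runit]] .
  have simp: "simple_obj C ((X \<boxtimes> D) \<boxtimes> E)"
    by (rule isomorphic_simple[OF isomorphic_sym[OF ex] assms(2)])
  have pi: "(p \<star> Id E) \<cdot> (i \<star> Id E) = Id (Y \<boxtimes> E)"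
    using tensm_Id_Comp[OF i(1,2), of E] i(3) by (simp add: tensm_Id)
  have "mono_mor C (Y \<boxtimes> E) ((X \<boxtimes> D) \<boxtimes> E) (i \<star> Id E)"
    by (rule split_mono[OF tensm_Id_right_closed[OF i(1)] tensm_Id_right_closed[OF i(2)] pi])
  moreover have "\<not> zero_obj C (Y \<boxtimes> E)"
    using invertible_tens_zero_obj(2)[OF invE] simple_nonzero[OF Y(1)] by blast
  ultimately have iso: "iso_mor C (Y \<boxtimes> E) ((X \<boxtimes> D) \<boxtimes> E) (i \<star> Id E)"
    using simp by (auto simp: simple_obj_def)
  have ip: "i \<cdot> p \<in> Hom C (X \<boxtimes> D) (X \<boxtimes> D)" by (rule Comp_closed[OF i(2,1)])
  have d: "i \<cdot> p - Id (X \<boxtimes> D) \<in> Hom C (X \<boxtimes> D) (X \<boxtimes> D)"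
    by (rule Hom_diff[OF ip Id_closed])
  have "(i \<cdot> p - Id (X \<boxtimes> D)) \<cdot> i = 0"
    using Comp_diff_left[OF i(1) ip Id_closed] Comp_assoc[OF i(1,2,1)] i(3)
      Comp_Id_left[OF i(1)] Comp_Id_right[OF i(1)] by simp
  then have "((i \<cdot> p - Id (X \<boxtimes> D)) \<star> Id E) \<cdot> (i \<star> Id E) = 0"
    using tensm_Id_Comp[OF i(1) d, of E] tensm_0_left[OF Id_closed] by simp
  then have "(i \<cdot> p - Id (X \<boxtimes> D)) \<star> Id E = 0"
    using iso_cancel_right[OF iso tensm_Id_right_closed[OF d]] by blast
  then have "i \<cdot> p = Id (X \<boxtimes> D)"
    using invertible_tensm_eq_0_right[OF invE d] by simp
  then have "isomorphic C Y (X \<boxtimes> D)"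
    using i by (auto simp: isomorphic_def iso_mor_def inverse_mor_def)
  then show ?thesis using isomorphic_simple Y(1) by blast
qed

section \<open>Additive and fusion subcategories\<close>

lemma additive_subcat_direct_sum:
  "additive_subcat C S \<Longrightarrow> is_direct_sum C (I :: nat set) F Z \<Longrightarrow> (\<And>i. i \<in> I \<Longrightarrow> F i \<in> S) \<Longrightarrow> Z \<in> S"
  unfolding additive_subcat_def by blast

lemma additive_subcat_summand:
  "additive_subcat C S \<Longrightarrow> Z \<in> S \<Longrightarrow> is_summand C Y Z \<Longrightarrow> Y \<in> S"
  unfolding additive_subcat_def by blast

lemma additive_subcat_isomorphic:
  "additive_subcat C S \<Longrightarrow> X \<in> S \<Longrightarrow> isomorphic C X Y \<Longrightarrow> Y \<in> S"
  by (rule additive_subcat_summand[OF _ _ isomorphic_is_summand[OF isomorphic_sym]])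

lemma additive_subcat_mem_iff:
  assumes "additive_subcat C S"
  shows "X \<in> S \<longleftrightarrow> (\<forall>Y. simple_obj C Y \<longrightarrow> is_summand C Y X \<longrightarrow> Y \<in> S)"
proof
  assume *: "\<forall>Y. simple_obj C Y \<longrightarrow> is_summand C Y X \<longrightarrow> Y \<in> S"
  obtain I :: "nat set" and F where F: "\<forall>i\<in>I. simple_obj C (F i)" "is_direct_sum C I F X"
    using semisimple by blast
  show "X \<in> S"
    using * F(1) direct_sum_is_summand[OF F(2)] by (intro additive_subcat_direct_sum[OF assms F(2)]) blast
qed (use additive_subcat_summand[OF assms] in blast)

text \<open>Taken with \<open>P Y\<close> saying that the degree of \<open>Y\<close> lies in a given
  set, this yields the additivity of sums of graded components.\<close>

lemma additive_subcat_simples: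
  "additive_subcat C {X. \<forall>Y. simple_obj C Y \<longrightarrow> is_summand C Y X \<longrightarrow> P Y}" (is "additive_subcat C ?S")
  unfolding additive_subcat_def
proof (intro conjI allI impI)
  fix I :: "nat set" and F Z
  assume *: "\<forall>i\<in>I. F i \<in> ?S" "is_direct_sum C I F Z"
  show "Z \<in> ?S" using simple_summand_direct_sum[OF _ *(2)] *(1) by blast
next
  fix Y Z assume *: "Z \<in> ?S" "is_summand C Y Z"
  show "Y \<in> ?S" using *(1) is_summand_trans[OF _ *(2)] by blast
qed

lemma fusion_subcatD:
  assumes "fusion_subcat C S"
  shows "additive_subcat C S" "\<I> \<in> S" "X \<in> S \<Longrightarrow> Y \<in> S \<Longrightarrow> X \<boxtimes> Y \<in> S"
    "X \<in> S \<Longrightarrow> left_dual C X V \<Longrightarrow> V \<in> S" "X \<in> S \<Longrightarrow> left_dual C V X \<Longrightarrow> V \<in> S"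
proof -
  note * = assms[unfolded fusion_subcat_def]
  show "additive_subcat C S" "\<I> \<in> S" using * by simp_all
  show "X \<in> S \<Longrightarrow> Y \<in> S \<Longrightarrow> X \<boxtimes> Y \<in> S"
    using *[THEN conjunct2, THEN conjunct2, THEN conjunct1] by blast
  show "X \<in> S \<Longrightarrow> left_dual C X V \<Longrightarrow> V \<in> S" "X \<in> S \<Longrightarrow> left_dual C V X \<Longrightarrow> V \<in> S"
    using *[THEN conjunct2, THEN conjunct2, THEN conjunct2] by blast+
qed

section \<open>Duality expressed through occurrences of the unit object\<close>

lemma unit_summand_of_left_dual:
  assumes "left_dual C X V" "simple_obj C Q" "is_summand C Q V"
  shows "is_summand C \<I> (X \<boxtimes> Q)"
proof -
  obtain \<pi> where \<pi>: "\<pi> \<in> Hom C V Q" "\<pi> \<noteq> 0" using simple_summandE[OF assms(2,3)] by blast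
  show ?thesis
    by (rule left_dual_nonzero_quotient[OF assms(1) \<pi>]) (rule simple_into_is_summand[OF simple_unit])
qed

lemma unit_summand_of_right_dual:
  assumes "left_dual C V X" "simple_obj C Q" "is_summand C Q V"
  shows "is_summand C \<I> (Q \<boxtimes> X)"
proof -
  obtain \<pi> where \<pi>: "\<pi> \<in> Hom C V Q" "\<pi> \<noteq> 0" using simple_summandE[OF assms(2,3)] by blast
  show ?thesis
    by (rule right_dual_nonzero_quotient[OF assms(1) \<pi>]) (rule simple_into_is_summand[OF simple_unit])
qed

text \<open>A converse to the two preceding lemmas and a substitute for the uniqueness of duals: the
  occurrence of the unit in \<open>A \<boxtimes> V\<close> transposes to a nonzero morphism from
  \<open>Z\<close> to \<open>A\<close>, which splits because \<open>A\<close> is simple.\<close>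

lemma summand_of_right_dual:
  assumes "left_dual C Z V" "simple_obj C A" "is_summand C \<I> (A \<boxtimes> V)"
  shows "is_summand C A Z"
proof -
  obtain f where f: "f \<in> Hom C \<I> (A \<boxtimes> V)" "f \<noteq> 0"
    using simple_summandE[OF simple_unit assms(3)] by blast
  show ?thesis
    by (rule left_dual_nonzero_transpose[OF assms(1) f]) (rule simple_from_is_summand[OF assms(2)])
qed

text \<open>Supplies a simple substitute for the dual inside \<open>S\<close>. The dual
  \<open>V\<close> is not known to be simple, so the unit is located in
  \<open>A \<boxtimes> B\<close> for simple summands \<open>A\<close> of \<open>X\<close> and
  \<open>B\<close> of \<open>V\<close>, and \<open>A\<close> is enlarged to \<open>X\<close>
  again.\<close>

lemma ex_simple_unit_summand_right:
  assumes "fusion_subcat C S" "simple_obj C X" "X \<in> S"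
  obtains V where "simple_obj C V" "V \<in> S" "is_summand C \<I> (X \<boxtimes> V)"
proof -
  obtain V where V: "left_dual C X V" using ex_left_dual[of X] by (elim exE)
  then have "V \<in> S" by (rule fusion_subcatD(4)[OF assms(1,3)])
  have "is_summand C \<I> (X \<boxtimes> V)" by (rule unit_summand_of_right_dual[OF V assms(2) is_summand_refl])
  then obtain A B where AB: "simple_obj C A" "is_summand C A X" "simple_obj C B" "is_summand C B V"
    "is_summand C \<I> (A \<boxtimes> B)"
    by (rule simple_summand_tens[OF simple_unit])
  have "is_summand C \<I> (X \<boxtimes> B)"
    using is_summand_trans[OF AB(5) is_summand_tens[OF AB(2) is_summand_refl]] .
  then show ?thesis
    by (rule that[OF AB(3) additive_subcat_summand[OF fusion_subcatD(1)[OF assms(1)] \<open>V \<in> S\<close> AB(4)]])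
qed

lemma ex_simple_unit_summand_left:
  assumes "fusion_subcat C S" "simple_obj C X" "X \<in> S"
  obtains V where "simple_obj C V" "V \<in> S" "is_summand C \<I> (V \<boxtimes> X)"
proof -
  obtain V where V: "left_dual C V X" using ex_right_dual[of X] by (elim exE)
  then have "V \<in> S" by (rule fusion_subcatD(5)[OF assms(1,3)])
  have "is_summand C \<I> (V \<boxtimes> X)" by (rule unit_summand_of_left_dual[OF V assms(2) is_summand_refl])
  then obtain A B where AB: "simple_obj C A" "is_summand C A V" "simple_obj C B" "is_summand C B X"
    "is_summand C \<I> (A \<boxtimes> B)"
    by (rule simple_summand_tens[OF simple_unit])
  have "is_summand C \<I> (A \<boxtimes> X)"
    using is_summand_trans[OF AB(5) is_summand_tens[OF is_summand_refl AB(4)]] .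
  then show ?thesis
    by (rule that[OF AB(1) additive_subcat_summand[OF fusion_subcatD(1)[OF assms(1)] \<open>V \<in> S\<close> AB(2)]])
qed

text \<open>As \<open>V\<close> is invertible, \<open>X \<boxtimes> V\<close> is simple, and a
  simple object containing the unit is isomorphic to it.\<close>

lemma invertible_if_unit_summand:
  assumes "simple_obj C X" "invertible_obj C V" "is_summand C \<I> (X \<boxtimes> V)"
  shows "invertible_obj C X"
proof -
  have "isomorphic C (X \<boxtimes> V) \<I>"
    using simple_summand_simple[OF simple_unit simple_tens_right[OF assms(2,1)] assms(3)]
    by (rule isomorphic_sym)
  then show ?thesis using invertible_if_tens_invertible[OF assms(2)] by blast
qed

lemma unit_in_adjoint: "\<I> \<in> adjoint_subcat C"
  unfolding adjoint_subcat_def generated_subcat_def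
proof (rule InterI)
  fix S assume "S \<in> {S. fusion_subcat C S
    \<and> {Y. simple_obj C Y \<and> (\<exists>X. simple_obj C X \<and> is_summand C Y (X \<boxtimes> dual C X))} \<subseteq> S}"
  then show "\<I> \<in> S" using fusion_subcatD(2)[of S] by simp
qed

lemma left_dual_dual: "left_dual C X (dual C X)"
  unfolding dual_def by (rule someI_ex[OF ex_left_dual])

lemma summand_in_adjoint:
  assumes "simple_obj C X" "simple_obj C Y" "is_summand C Y (X \<boxtimes> dual C X)"
  shows "Y \<in> adjoint_subcat C"
proof -
  have Y: "Y \<in> {Y. simple_obj C Y \<and> (\<exists>X. simple_obj C X \<and> is_summand C Y (X \<boxtimes> dual C X))}"
    using assms by blast
  show ?thesis
    unfolding adjoint_subcat_def generated_subcat_def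
  proof (intro InterI, elim CollectE conjE)
    fix S assume "{Y. simple_obj C Y \<and> (\<exists>X. simple_obj C X \<and> is_summand C Y (X \<boxtimes> dual C X))} \<subseteq> S"
    then show "Y \<in> S" using Y by (rule subsetD)
  qed
qed

end

section \<open>The universal grading\<close>

text \<open>Additivity of the adjoint subcategory and its behaviour under tensor products are read
  off from \<open>degree_one\<close>, which identifies it with the trivial component, rather than
  from its definition as an intersection.\<close>

locale universally_graded = fusion_category C
  for C :: "('o, 'm::ab_group_add, 'k::{alg_closed_field, field_char_0}) tensor_data" (structure) +
  fixes U :: "'u monoid" and D :: "'u \<Rightarrow> 'o set"
  assumes universal: "universal_grading C U D"
begin

lemma faithful: "faithful_grading C U D"
  and degree_one: "D \<one>\<^bsub>U\<^esub> = adjoint_subcat C"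
  using universal by (simp_all add: universal_grading_def)

lemma is_grading: "grading C U D"
  using faithful by (simp add: faithful_grading_def)

sublocale U: group U
  using is_grading by (simp add: grading_def)

lemma additive_degree: "g \<in> carrier U \<Longrightarrow> additive_subcat C (D g)"
  using is_grading by (simp add: grading_def)

lemma degree_orthogonal:
  assumes "g \<in> carrier U" "h \<in> carrier U" "g \<noteq> h" "X \<in> D g" "Y \<in> D h"
  shows "Hom C X Y = {0}"
  using is_grading assms by (simp add: grading_def)

lemma degree_tens:
  assumes "g \<in> carrier U" "h \<in> carrier U" "X \<in> D g" "Y \<in> D h"
  shows "X \<boxtimes> Y \<in> D (g \<otimes>\<^bsub>U\<^esub> h)"
  using is_grading assms by (simp add: grading_def)

lemma component_sum_carrier: "component_sum C D (carrier U) = UNIV"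
  using is_grading by (simp add: grading_def)

lemma ex_degree_decomposition:
  obtains I F where "I \<subseteq> carrier U" "\<forall>g\<in>I. F g \<in> D g" "is_direct_sum C I F X"
proof -
  have "X \<in> component_sum C D (carrier U)" by (simp add: component_sum_carrier)
  then obtain I F where "I \<subseteq> carrier U" "\<forall>g\<in>I. F g \<in> D g" "is_direct_sum C I F X"
    unfolding component_sum_def by (elim CollectE exE conjE)
  then show ?thesis by (rule that)
qed

lemma ex_degree:
  assumes "simple_obj C Y"
  obtains g where "g \<in> carrier U" "Y \<in> D g"
proof -
  obtain I F where I: "I \<subseteq> carrier U" and F: "\<forall>g\<in>I. F g \<in> D g"
    and sum: "is_direct_sum C I F Y"
    by (rule ex_degree_decomposition)
  obtain g where g: "g \<in> I" "is_summand C Y (F g)"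
    by (rule simple_summand_direct_sum[OF assms sum is_summand_refl])
  then have "g \<in> carrier U" using I by blast
  then show ?thesis
    by (rule that) (rule additive_subcat_summand[OF additive_degree F[rule_format, OF g(1)] g(2)], fact)
qed

lemma degree_unique:
  assumes "simple_obj C Y" "g \<in> carrier U" "h \<in> carrier U" "Y \<in> D g" "Y \<in> D h"
  shows "g = h"
proof (rule ccontr)
  assume "g \<noteq> h"
  then have "Hom C Y Y = {0}" using degree_orthogonal assms(2-5) by blast
  then show False using Id_closed[of Y] simple_nonzero[OF assms(1)] by (simp add: zero_obj_def)
qed

lemma unit_degree: "\<I> \<in> D \<one>\<^bsub>U\<^esub>"
  by (simp add: degree_one unit_in_adjoint)

text \<open>Plays the part of the statement that dual objects have inverse degrees: the product has
  degree \<open>g \<otimes> h\<close>, its summand inherits this degree, and the unit has degree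
  one.\<close>

lemma degree_unit_summand:
  assumes "g \<in> carrier U" "h \<in> carrier U" "X \<in> D g" "Y \<in> D h" "is_summand C \<I> (X \<boxtimes> Y)"
  shows "g \<otimes>\<^bsub>U\<^esub> h = \<one>\<^bsub>U\<^esub>"
proof -
  have gh: "g \<otimes>\<^bsub>U\<^esub> h \<in> carrier U" using assms(1,2) by simp
  have "\<I> \<in> D (g \<otimes>\<^bsub>U\<^esub> h)"
    by (rule additive_subcat_summand[OF additive_degree[OF gh] degree_tens[OF assms(1-4)] assms(5)])
  then show ?thesis by (intro degree_unique[OF simple_unit gh _ _ unit_degree]) simp_all
qed

lemma ex_simple_of_degree:
  assumes "g \<in> carrier U"
  obtains Y where "simple_obj C Y" "Y \<in> D g"
proof -
  have "\<exists>X\<in>D g. \<not> zero_obj C X" using faithful assms by (simp add: faithful_grading_def)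
  then obtain X where X: "X \<in> D g" "\<not> zero_obj C X" by (elim bexE)
  obtain Y where Y: "simple_obj C Y" "is_summand C Y X" by (rule ex_simple_summand[OF X(2)])
  show ?thesis
    by (rule that[OF Y(1) additive_subcat_summand[OF additive_degree[OF assms] X(1) Y(2)]])
qed

text \<open>Replaces the existence of a decomposition by a condition on simple summands, the form in
  which additivity and closure are checked. For the converse inclusion, a piece \<open>F g\<close>
  with \<open>g\<close> outside \<open>H\<close> is zero: a simple summand of it would have degree
  \<open>g\<close> and also a degree in \<open>H\<close>.\<close>

lemma component_sum_eq:
  assumes "H \<subseteq> carrier U"
  shows "component_sum C D H = {X. \<forall>Y. simple_obj C Y \<longrightarrow> is_summand C Y X \<longrightarrow> (\<exists>h\<in>H. Y \<in> D h)}"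
proof (intro equalityI subsetI CollectI allI impI)
  fix X Y assume "X \<in> component_sum C D H" and Y: "simple_obj C Y" "is_summand C Y X"
  then obtain I F where I: "I \<subseteq> H" and F: "\<forall>g\<in>I. F g \<in> D g" and sum: "is_direct_sum C I F X"
    unfolding component_sum_def by (elim CollectE exE conjE)
  obtain g where g: "g \<in> I" "is_summand C Y (F g)"
    by (rule simple_summand_direct_sum[OF Y(1) sum Y(2)])
  then have "g \<in> carrier U" using I assms by blast
  then have "Y \<in> D g" using additive_subcat_summand[OF additive_degree _ g(2)] F g(1) by simp
  then show "\<exists>h\<in>H. Y \<in> D h" using g(1) I by blast
next
  fix X assume *: "X \<in> {X. \<forall>Y. simple_obj C Y \<longrightarrow> is_summand C Y X \<longrightarrow> (\<exists>h\<in>H. Y \<in> D h)}"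
  obtain I F where I: "I \<subseteq> carrier U" and F: "\<forall>g\<in>I. F g \<in> D g"
    and sum: "is_direct_sum C I F X"
    by (rule ex_degree_decomposition)
  have zero: "zero_obj C (F g)" if g: "g \<in> I" "g \<notin> H" for g
  proof (rule ccontr)
    assume "\<not> zero_obj C (F g)"
    then obtain Y where Y: "simple_obj C Y" "is_summand C Y (F g)" by (rule ex_simple_summand)
    have gU: "g \<in> carrier U" using g I by blast
    have "Y \<in> D g" by (rule additive_subcat_summand[OF additive_degree[OF gU] F[rule_format, OF g(1)] Y(2)])
    moreover have "is_summand C Y X"
      by (rule is_summand_trans[OF Y(2) direct_sum_is_summand[OF sum g(1)]])
    then obtain h where h: "h \<in> H" "Y \<in> D h" using * Y(1) by blast
    moreover have "h \<in> carrier U" using h assms by blast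
    ultimately have "g = h" using degree_unique[OF Y(1) gU] by simp
    then show False using g(2) h(1) by simp
  qed
  have "is_direct_sum C (I \<inter> H) F X"
  proof -
    from sum obtain \<iota> \<pi> where fin: "finite I"
      and *: "\<forall>i\<in>I. \<iota> i \<in> Hom C (F i) X \<and> \<pi> i \<in> Hom C X (F i)"
      and orth: "\<forall>i\<in>I. \<forall>j\<in>I. \<pi> i \<cdot> \<iota> j = (if i = j then Id (F i) else 0)"
      and eq: "(\<Sum>i\<in>I. \<iota> i \<cdot> \<pi> i) = Id X"
      unfolding is_direct_sum_def by (elim conjE exE) blast
    have "\<iota> i \<cdot> \<pi> i = 0" if i: "i \<in> I - I \<inter> H" for i
    proof -
      have \<iota>: "\<iota> i \<in> Hom C (F i) X" and \<pi>: "\<pi> i \<in> Hom C X (F i)" using * i by auto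
      have "zero_obj C (F i)" using zero i by blast
      then have "\<pi> i = 0" using \<pi> by (rule zero_obj_Hom_into)
      then show ?thesis using Comp_0_right[OF \<iota>] by simp
    qed
    then have "(\<Sum>i\<in>I \<inter> H. \<iota> i \<cdot> \<pi> i) = (\<Sum>i\<in>I. \<iota> i \<cdot> \<pi> i)"
      by (intro sum.mono_neutral_left fin Int_lower1 ballI)
    then have "(\<Sum>i\<in>I \<inter> H. \<iota> i \<cdot> \<pi> i) = Id X" using eq by (rule trans)
    moreover have "\<forall>i\<in>I \<inter> H. \<iota> i \<in> Hom C (F i) X \<and> \<pi> i \<in> Hom C X (F i)" using * by blast
    moreover have "\<forall>i\<in>I \<inter> H. \<forall>j\<in>I \<inter> H. \<pi> i \<cdot> \<iota> j = (if i = j then Id (F i) else 0)"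
      using orth by blast
    ultimately show ?thesis
      unfolding is_direct_sum_def using fin
      by (intro conjI exI[of _ \<iota>] exI[of _ \<pi>] finite_Int) blast+
  qed
  moreover have "\<forall>g\<in>I \<inter> H. F g \<in> D g" using F by blast
  moreover have "I \<inter> H \<subseteq> H" by blast
  ultimately show "X \<in> component_sum C D H" unfolding component_sum_def by blast
qed

lemma degree_subset_component_sum:
  assumes "H \<subseteq> carrier U" "h \<in> H"
  shows "D h \<subseteq> component_sum C D H"
proof
  fix X assume "X \<in> D h"
  have h: "h \<in> carrier U" using assms by blast
  have "Y \<in> D h" if "is_summand C Y X" for Y
    by (rule additive_subcat_summand[OF additive_degree[OF h] \<open>X \<in> D h\<close> that])
  then show "X \<in> component_sum C D H" unfolding component_sum_eq[OF assms(1)] using assms(2) by blast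
qed

lemma simple_component_sum:
  assumes "H \<subseteq> carrier U" "simple_obj C Y" "Y \<in> component_sum C D H"
  obtains h where "h \<in> H" "h \<in> carrier U" "Y \<in> D h"
proof -
  obtain h where "h \<in> H" "Y \<in> D h"
    using assms(2,3) is_summand_refl[of Y] unfolding component_sum_eq[OF assms(1)] by blast
  then show ?thesis using that[of h] assms(1) by blast
qed

text \<open>Faithfulness of the grading puts a simple object into every component, so
  \<open>H\<close> can be recovered from its component sum. Injectivity of the correspondence rests
  on this.\<close>

lemma component_sum_degree_iff:
  assumes "H \<subseteq> carrier U" "g \<in> carrier U"
  shows "g \<in> H \<longleftrightarrow> (\<exists>Y\<in>D g. simple_obj C Y \<and> Y \<in> component_sum C D H)"
proof
  assume g: "g \<in> H"
  obtain Y where "simple_obj C Y" "Y \<in> D g" by (rule ex_simple_of_degree[OF assms(2)])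
  then show "\<exists>Y\<in>D g. simple_obj C Y \<and> Y \<in> component_sum C D H"
    using degree_subset_component_sum[OF assms(1) g] by blast
next
  assume "\<exists>Y\<in>D g. simple_obj C Y \<and> Y \<in> component_sum C D H"
  then obtain Y where Y: "Y \<in> D g" "simple_obj C Y" "Y \<in> component_sum C D H" by (elim bexE conjE)
  obtain h where "h \<in> H" "h \<in> carrier U" "Y \<in> D h" by (rule simple_component_sum[OF assms(1) Y(2,3)])
  then show "g \<in> H" using degree_unique[OF Y(2) assms(2) _ Y(1)] by simp
qed

lemma inj_on_component_sum: "inj_on (component_sum C D) {H. subgroup H U}"
proof (rule inj_onI)
  fix H H' assume "H \<in> {H. subgroup H U}" "H' \<in> {H. subgroup H U}"
    and eq: "component_sum C D H = component_sum C D H'"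
  then have sub: "H \<subseteq> carrier U" "H' \<subseteq> carrier U" by (auto dest: subgroup.subset)
  have "g \<in> H \<longleftrightarrow> g \<in> H'" if "g \<in> carrier U" for g
    unfolding component_sum_degree_iff[OF sub(1) that] component_sum_degree_iff[OF sub(2) that] eq
    by (rule refl)
  then show "H = H'" using sub by blast
qed

text \<open>Degrees multiply under tensor products. A simple summand \<open>Q\<close> of a dual of
  \<open>X\<close> has the unit in its product with some simple summand of \<open>X\<close>, so its
  degree is the inverse of an element of \<open>H\<close>.\<close>

lemma fusion_component_sum:
  assumes "subgroup H U"
  shows "fusion_subcat C (component_sum C D H)"
proof -
  have H: "H \<subseteq> carrier U" by (rule subgroup.subset[OF assms])
  note eq = component_sum_eq[OF H]
  have add: "additive_subcat C (component_sum C D H)"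
    unfolding eq by (rule additive_subcat_simples)
  have "\<I> \<in> component_sum C D H"
    using degree_subset_component_sum[OF H subgroup.one_closed[OF assms]] unit_degree by blast
  moreover have "X \<boxtimes> Y \<in> component_sum C D H"
    if X: "X \<in> component_sum C D H" and Y: "Y \<in> component_sum C D H" for X Y
    unfolding eq
  proof (intro CollectI allI impI)
    fix Q assume Q: "simple_obj C Q" "is_summand C Q (X \<boxtimes> Y)"
    obtain A B where AB: "simple_obj C A" "is_summand C A X" "simple_obj C B" "is_summand C B Y"
      "is_summand C Q (A \<boxtimes> B)"
      by (rule simple_summand_tens[OF Q])
    obtain g where g: "g \<in> H" "g \<in> carrier U" "A \<in> D g"
      by (rule simple_component_sum[OF H AB(1) additive_subcat_summand[OF add X AB(2)]])
    obtain h where h: "h \<in> H" "h \<in> carrier U" "B \<in> D h"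
      by (rule simple_component_sum[OF H AB(3) additive_subcat_summand[OF add Y AB(4)]])
    have gh: "g \<otimes>\<^bsub>U\<^esub> h \<in> carrier U" using g(2) h(2) by simp
    have "Q \<in> D (g \<otimes>\<^bsub>U\<^esub> h)"
      by (rule additive_subcat_summand[OF additive_degree[OF gh]
            degree_tens[OF g(2) h(2) g(3) h(3)] AB(5)])
    then show "\<exists>h\<in>H. Q \<in> D h" using subgroup.m_closed[OF assms g(1) h(1)] by blast
  qed
  moreover have "V \<in> component_sum C D H"
    if X: "X \<in> component_sum C D H" and V: "left_dual C X V \<or> left_dual C V X" for X V
    unfolding eq
  proof (intro CollectI allI impI)
    fix Q assume Q: "simple_obj C Q" "is_summand C Q V"
    obtain u where u: "u \<in> carrier U" "Q \<in> D u" by (rule ex_degree[OF Q(1)])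
    from V show "\<exists>h\<in>H. Q \<in> D h"
    proof
      assume "left_dual C X V"
      then have "is_summand C \<I> (X \<boxtimes> Q)" by (rule unit_summand_of_left_dual[OF _ Q])
      then obtain A B where AB: "simple_obj C A" "is_summand C A X" "simple_obj C B" "is_summand C B Q"
        "is_summand C \<I> (A \<boxtimes> B)"
        by (rule simple_summand_tens[OF simple_unit])
      have AQ: "is_summand C \<I> (A \<boxtimes> Q)"
        by (rule is_summand_trans[OF AB(5) is_summand_tens[OF is_summand_refl AB(4)]])
      obtain g where g: "g \<in> H" "g \<in> carrier U" "A \<in> D g"
        by (rule simple_component_sum[OF H AB(1) additive_subcat_summand[OF add X AB(2)]])
      have "u = inv\<^bsub>U\<^esub> g"
        using U.inv_equality[OF degree_unit_summand[OF g(2) u(1) g(3) u(2) AQ] u(1) g(2)]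
          U.inv_inv[OF u(1)] by simp
      then show ?thesis using subgroup.m_inv_closed[OF assms g(1)] u(2) by blast
    next
      assume "left_dual C V X"
      then have "is_summand C \<I> (Q \<boxtimes> X)" by (rule unit_summand_of_right_dual[OF _ Q])
      then obtain A B where AB: "simple_obj C A" "is_summand C A Q" "simple_obj C B" "is_summand C B X"
        "is_summand C \<I> (A \<boxtimes> B)"
        by (rule simple_summand_tens[OF simple_unit])
      have QB: "is_summand C \<I> (Q \<boxtimes> B)"
        by (rule is_summand_trans[OF AB(5) is_summand_tens[OF AB(2) is_summand_refl]])
      obtain g where g: "g \<in> H" "g \<in> carrier U" "B \<in> D g"
        by (rule simple_component_sum[OF H AB(3) additive_subcat_summand[OF add X AB(4)]])
      have "u = inv\<^bsub>U\<^esub> g"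
        using U.inv_equality[OF degree_unit_summand[OF u(1) g(2) u(2) g(3) QB] g(2) u(1)] by simp
      then show ?thesis using subgroup.m_inv_closed[OF assms g(1)] u(2) by blast
    qed
  qed
  ultimately show ?thesis unfolding fusion_subcat_def using add by (intro conjI ballI allI impI)
qed

text \<open>The inverse \<open>E\<close> of \<open>\<delta>\<close> has the inverse degree, so
  tensoring with \<open>E\<close> moves \<open>D g\<close> into the trivial component and tensoring
  with \<open>\<delta>\<close> moves it back; both preserve simplicity.\<close>

lemma Irr_degree_eq:
  assumes "g \<in> carrier U" "\<delta> \<in> D g" "simple_obj C \<delta>" "invertible_obj C \<delta>"
  shows "Irr C (D g) = class_tens C (iso_class C \<delta>) ` Irr C (adjoint_subcat C)"
proof (intro equalityI subsetI)
  fix A assume "A \<in> Irr C (D g)"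
  then obtain Z where A: "A = iso_class C Z" and Z: "Z \<in> D g" "simple_obj C Z" by (auto simp: Irr_def)
  obtain E where E: "isomorphic C (\<delta> \<boxtimes> E) \<I>" "isomorphic C (E \<boxtimes> \<delta>) \<I>"
    using assms(4) unfolding invertible_obj_def by (elim exE conjE)
  have invE: "invertible_obj C E" using E unfolding invertible_obj_def by (intro exI[of _ \<delta>] conjI)
  have "simple_obj C E"
    by (rule isomorphic_simple[OF isomorphic_runit simple_tens_left[OF invE simple_unit]])
  then obtain h where h: "h \<in> carrier U" "E \<in> D h" by (rule ex_degree)
  have hg: "h \<otimes>\<^bsub>U\<^esub> g = \<one>\<^bsub>U\<^esub>"
    by (rule degree_unit_summand[OF h(1) assms(1) h(2) assms(2)
          isomorphic_is_summand[OF isomorphic_sym[OF E(2)]]])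
  have "E \<boxtimes> Z \<in> adjoint_subcat C"
    using degree_tens[OF h(1) assms(1) h(2) Z(1)] hg degree_one by simp
  then have "iso_class C (E \<boxtimes> Z) \<in> Irr C (adjoint_subcat C)"
    using simple_tens_left[OF invE Z(2)] by (auto simp: Irr_def)
  moreover have "isomorphic C (\<delta> \<boxtimes> (E \<boxtimes> Z)) Z"
    by (rule isomorphic_trans[OF isomorphic_sym[OF isomorphic_assoc]
          isomorphic_trans[OF isomorphic_tens[OF E(1) isomorphic_refl] isomorphic_lunit]])
  then have "A = class_tens C (iso_class C \<delta>) (iso_class C (E \<boxtimes> Z))"
    unfolding A class_tens_iso_class iso_class_eq_iff by (rule isomorphic_sym)
  ultimately show "A \<in> class_tens C (iso_class C \<delta>) ` Irr C (adjoint_subcat C)" by (rule rev_image_eqI)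
next
  fix A assume "A \<in> class_tens C (iso_class C \<delta>) ` Irr C (adjoint_subcat C)"
  then obtain W where W: "W \<in> adjoint_subcat C" "simple_obj C W"
    and A: "A = class_tens C (iso_class C \<delta>) (iso_class C W)" by (auto simp: Irr_def)
  have "\<delta> \<boxtimes> W \<in> D g"
    using degree_tens[OF assms(1) U.one_closed assms(2)] W(1) assms(1) by (simp add: degree_one)
  then show "A \<in> Irr C (D g)"
    unfolding A class_tens_iso_class Irr_def using simple_tens_left[OF assms(4) W(2)] by blast
qed

end

section \<open>Generalized near-group categories\<close>

text \<open>The orbit condition restated for objects, so that the arguments below need neither
  isomorphism classes nor \<open>inv_group\<close>.\<close>

locale near_group_transitive = fusion_category C
  for C :: "('o, 'm::ab_group_add, 'k::{alg_closed_field, field_char_0}) tensor_data" (structure) +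
  assumes transitive: "simple_obj C Y \<Longrightarrow> \<not> invertible_obj C Y \<Longrightarrow>
    simple_obj C Z \<Longrightarrow> \<not> invertible_obj C Z \<Longrightarrow>
    \<exists>\<delta>. simple_obj C \<delta> \<and> invertible_obj C \<delta> \<and> isomorphic C Z (\<delta> \<boxtimes> Y)"
begin

text \<open>
  Let \<open>Z \<in> S\<close> be simple and not invertible, \<open>V\<close> dual to \<open>Z\<close>, and \<open>B\<close> dual to another such \<open>X\<close>.
  Then \<open>B \<cong> \<delta> \<otimes> V\<close> by transitivity, so \<open>X \<otimes> B \<cong> (X \<otimes> \<delta>) \<otimes> V\<close> contains the unit, which forces
  \<open>X \<otimes> \<delta> \<cong> Z\<close> and \<open>X \<otimes> B \<in> S\<close>.
\<close>

lemma adjoint_subset: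
  assumes S: "fusion_subcat C S" and Z: "Z \<in> S" "simple_obj C Z" "\<not> invertible_obj C Z"
  shows "adjoint_subcat C \<subseteq> S"
proof -
  note add = fusion_subcatD(1)[OF S]
  have pair: "X \<boxtimes> B \<in> S"
    if X: "simple_obj C X" and B: "simple_obj C B" and XB: "is_summand C \<I> (X \<boxtimes> B)" for X B
  proof (cases "invertible_obj C X")
    \<comment> \<open>Here \<open>X\<close> itself need not lie in \<open>S\<close>; only the
      product does, being a copy of the unit.\<close>
    case True
    have "isomorphic C \<I> (X \<boxtimes> B)"
      by (rule simple_summand_simple[OF simple_unit simple_tens_left[OF True B] XB])
    then show ?thesis by (rule additive_subcat_isomorphic[OF add fusion_subcatD(2)[OF S]])
  next
    case False
    then have nB: "\<not> invertible_obj C B" using invertible_if_unit_summand[OF X _ XB] by blast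
    obtain V where V: "simple_obj C V" "V \<in> S" "is_summand C \<I> (Z \<boxtimes> V)"
      by (rule ex_simple_unit_summand_right[OF S Z(2,1)])
    then have nV: "\<not> invertible_obj C V" using invertible_if_unit_summand[OF Z(2) _ V(3)] Z(3) by blast
    obtain \<delta> where \<delta>: "simple_obj C \<delta>" "invertible_obj C \<delta>" "isomorphic C B (\<delta> \<boxtimes> V)"
      using transitive[OF V(1) nV B nB] by (elim exE conjE)
    have iso: "isomorphic C (X \<boxtimes> B) ((X \<boxtimes> \<delta>) \<boxtimes> V)"
      by (rule isomorphic_trans[OF isomorphic_tens[OF isomorphic_refl \<delta>(3)]
            isomorphic_sym[OF isomorphic_assoc]])
    obtain W where W: "left_dual C W V" using ex_right_dual[of V] by (elim exE)
    have "is_summand C (X \<boxtimes> \<delta>) W"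
      by (rule summand_of_right_dual[OF W simple_tens_right[OF \<delta>(2) X]
            is_summand_trans[OF XB isomorphic_is_summand[OF iso]]])
    then have "X \<boxtimes> \<delta> \<in> S"
      by (rule additive_subcat_summand[OF add fusion_subcatD(5)[OF S V(2) W]])
    then show ?thesis
      by (intro additive_subcat_isomorphic[OF add fusion_subcatD(3)[OF S _ V(2)] isomorphic_sym[OF iso]])
  qed
  have "Y \<in> S" if Y: "simple_obj C Y" and X: "simple_obj C X" and XY: "is_summand C Y (X \<boxtimes> dual C X)"
    for X Y
  proof -
    \<comment> \<open>The claim \<open>pair\<close> concerns simple factors, so
      \<open>dual C X\<close> is first cut down to a simple summand \<open>B\<close>; the product of
      \<open>X\<close> with any such \<open>B\<close> contains the unit.\<close>
    obtain A B where AB: "simple_obj C A" "is_summand C A X" "simple_obj C B"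
      "is_summand C B (dual C X)" "is_summand C Y (A \<boxtimes> B)"
      by (rule simple_summand_tens[OF Y XY])
    have "X \<boxtimes> B \<in> S"
      by (rule pair[OF X AB(3) unit_summand_of_left_dual[OF left_dual_dual AB(3,4)]])
    then show ?thesis
      by (rule additive_subcat_summand[OF add _
            is_summand_trans[OF AB(5) is_summand_tens[OF AB(2) is_summand_refl]]])
  qed
  then have "{Y. simple_obj C Y \<and> (\<exists>X. simple_obj C X \<and> is_summand C Y (X \<boxtimes> dual C X))} \<subseteq> S"
    by blast
  then show ?thesis unfolding adjoint_subcat_def generated_subcat_def using S by (intro Inter_lower) simp
qed

end

locale near_group_universally_graded = near_group_transitive C + universally_graded C U D
  for C :: "('o, 'm::ab_group_add, 'k::{alg_closed_field, field_char_0}) tensor_data" (structure)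
    and U :: "'u monoid" and D :: "'u \<Rightarrow> 'o set" +
  assumes adjoint_nonpointed: "\<not> pointed C (adjoint_subcat C)"
begin

text \<open>Since \<open>Y\<close> has degree one, the invertible factor in Z \<cong> \<delta>
  \<otimes> Y has the same degree as \<open>Z\<close>.\<close>

lemma ex_invertible_of_degree:
  assumes g: "g \<in> carrier U"
  shows "\<exists>\<delta>\<in>D g. simple_obj C \<delta> \<and> invertible_obj C \<delta>"
proof -
  obtain Z where Z: "simple_obj C Z" "Z \<in> D g" by (rule ex_simple_of_degree[OF g])
  show ?thesis
  proof (cases "invertible_obj C Z")
    case True
    then show ?thesis using Z by (intro bexI[of _ Z] conjI)
  next
    case False
    obtain Y where Y: "Y \<in> D \<one>\<^bsub>U\<^esub>" "simple_obj C Y" "\<not> invertible_obj C Y"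
      using adjoint_nonpointed by (auto simp: pointed_def degree_one)
    obtain \<delta> where \<delta>: "simple_obj C \<delta>" "invertible_obj C \<delta>" "isomorphic C Z (\<delta> \<boxtimes> Y)"
      using transitive[OF Y(2,3) Z(1) False] by (elim exE conjE)
    obtain h where h: "h \<in> carrier U" "\<delta> \<in> D h" by (rule ex_degree[OF \<delta>(1)])
    have "\<delta> \<boxtimes> Y \<in> D h" using degree_tens[OF h(1) U.one_closed h(2) Y(1)] h(1) by simp
    then have "Z \<in> D h"
      by (rule additive_subcat_isomorphic[OF additive_degree[OF h(1)] _ isomorphic_sym[OF \<delta>(3)]])
    then have "h = g" using degree_unique[OF Z(1) h(1) g _ Z(2)] by simp
    then show ?thesis using \<delta>(1,2) h(2) by (intro bexI[of _ \<delta>] conjI) simp_all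
  qed
qed

lemma component_sum_nonpointed:
  assumes "subgroup H U"
  shows "\<not> pointed C (component_sum C D H)"
  using degree_subset_component_sum[OF subgroup.subset[OF assms] subgroup.one_closed[OF assms]]
    adjoint_nonpointed
  unfolding pointed_def degree_one by blast

lemma degree_subset:
  assumes S: "fusion_subcat C S" "\<not> pointed C S"
    and g: "g \<in> carrier U" and Z: "Z \<in> D g" "Z \<in> S" "simple_obj C Z"
  shows "D g \<subseteq> S"
proof
  fix X assume X: "X \<in> D g"
  obtain N where "N \<in> S" "simple_obj C N" "\<not> invertible_obj C N"
    using S(2) unfolding pointed_def by blast
  then have ad: "adjoint_subcat C \<subseteq> S" by (rule adjoint_subset[OF S(1)])
  obtain V where V: "simple_obj C V" "V \<in> S" "is_summand C \<I> (V \<boxtimes> Z)"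
    by (rule ex_simple_unit_summand_left[OF S(1) Z(3,2)])
  obtain h where h: "h \<in> carrier U" "V \<in> D h" by (rule ex_degree[OF V(1)])
  have hg: "h \<otimes>\<^bsub>U\<^esub> g = \<one>\<^bsub>U\<^esub>" by (rule degree_unit_summand[OF h(1) g h(2) Z(1) V(3)])
  \<comment> \<open>The unit occurs in \<open>V \<boxtimes> Z\<close>, but the trivial component has
    to receive \<open>X \<boxtimes> V\<close>, so the inverse is needed on the other side.\<close>
  have "g \<otimes>\<^bsub>U\<^esub> h = \<one>\<^bsub>U\<^esub>" by (rule U.inv_comm[OF hg h(1) g])
  then have "X \<boxtimes> V \<in> adjoint_subcat C" using degree_tens[OF g h(1) X h(2)] degree_one by simp
  then have "X \<boxtimes> V \<in> S" by (rule subsetD[OF ad])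
  then have "(X \<boxtimes> V) \<boxtimes> Z \<in> S" by (rule fusion_subcatD(3)[OF S(1) _ Z(2)])
  moreover have "is_summand C X ((X \<boxtimes> V) \<boxtimes> Z)"
    \<comment> \<open>X \<cong> X \<otimes> 1 is a summand of X \<otimes> (V \<otimes> Z), which is
      isomorphic to (X \<otimes> V) \<otimes> Z.\<close>
    by (rule is_summand_trans[OF isomorphic_is_summand[OF isomorphic_sym[OF isomorphic_runit]]
          is_summand_trans[OF is_summand_tens[OF is_summand_refl V(3)]
            isomorphic_is_summand[OF isomorphic_sym[OF isomorphic_assoc]]]])
  ultimately show "X \<in> S" by (rule additive_subcat_summand[OF fusion_subcatD(1)[OF S(1)]])
qed

lemma fusion_subcat_eq_component_sum:
  assumes S: "fusion_subcat C S" "\<not> pointed C S"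
  shows "\<exists>H. subgroup H U \<and> S = component_sum C D H"
proof -
  note add = fusion_subcatD(1)[OF S(1)]
  define H where "H = {g \<in> carrier U. \<exists>Z\<in>D g. Z \<in> S \<and> simple_obj C Z}"
  have sub: "H \<subseteq> carrier U" by (auto simp: H_def)
  have D: "D g \<subseteq> S" if "g \<in> H" for g
    using that unfolding H_def by (elim CollectE conjE bexE) (rule degree_subset[OF S])
  have H: "g \<in> H" if "simple_obj C Z" "Z \<in> D g" "Z \<in> S" "g \<in> carrier U" for g Z
    unfolding H_def using that by blast
  have "subgroup H U"
  proof (rule U.subgroupI[OF sub])
    show "H \<noteq> {}" using H[OF simple_unit unit_degree fusion_subcatD(2)[OF S(1)] U.one_closed] by blast
  next
    fix g assume g: "g \<in> H"
    then obtain Z where gU: "g \<in> carrier U" and Z: "Z \<in> D g" "Z \<in> S" "simple_obj C Z"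
      unfolding H_def by (elim CollectE conjE bexE)
    obtain V where V: "simple_obj C V" "V \<in> S" "is_summand C \<I> (V \<boxtimes> Z)"
      by (rule ex_simple_unit_summand_left[OF S(1) Z(3,2)])
    obtain h where h: "h \<in> carrier U" "V \<in> D h" by (rule ex_degree[OF V(1)])
    have "inv\<^bsub>U\<^esub> g = h"
      by (rule U.inv_equality[OF degree_unit_summand[OF h(1) gU h(2) Z(1) V(3)] gU h(1)])
    then show "inv\<^bsub>U\<^esub> g \<in> H" using H[OF V(1) h(2) V(2) h(1)] by simp
  next
    fix g h assume gh: "g \<in> H" "h \<in> H"
    then have U: "g \<in> carrier U" "h \<in> carrier U" using sub by blast+
    \<comment> \<open>Membership in \<open>H\<close> asks for a simple object of the product degree,
      and a product of two simple objects may fail to be simple. With an invertible factor it is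
      simple, and that factor lies in \<open>S\<close> because all of \<open>D g\<close>
      does.\<close>
    obtain \<delta> where \<delta>: "\<delta> \<in> D g" "invertible_obj C \<delta>"
      using ex_invertible_of_degree[OF U(1)] by blast
    obtain Y where Y: "simple_obj C Y" "Y \<in> D h" by (rule ex_simple_of_degree[OF U(2)])
    have "\<delta> \<in> S" "Y \<in> S" by (rule subsetD[OF D[OF gh(1)] \<delta>(1)], rule subsetD[OF D[OF gh(2)] Y(2)])
    then have "\<delta> \<boxtimes> Y \<in> S" by (rule fusion_subcatD(3)[OF S(1)])
    then show "g \<otimes>\<^bsub>U\<^esub> h \<in> H"
      using H[OF simple_tens_left[OF \<delta>(2) Y(1)] degree_tens[OF U \<delta>(1) Y(2)]] U by simp
  qed
  moreover have "S = component_sum C D H"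
  proof (intro equalityI subsetI)
    fix X assume X: "X \<in> S"
    show "X \<in> component_sum C D H"
      unfolding component_sum_eq[OF sub]
    proof (intro CollectI allI impI)
      fix Y assume Y: "simple_obj C Y" "is_summand C Y X"
      obtain g where g: "g \<in> carrier U" "Y \<in> D g" by (rule ex_degree[OF Y(1)])
      have "g \<in> H" by (rule H[OF Y(1) g(2) additive_subcat_summand[OF add X Y(2)] g(1)])
      then show "\<exists>h\<in>H. Y \<in> D h" using g(2) by blast
    qed
  next
    fix X assume X: "X \<in> component_sum C D H"
    have "Y \<in> S" if Y: "simple_obj C Y" "is_summand C Y X" for Y
    proof -
      obtain h where "h \<in> H" "Y \<in> D h" using X Y unfolding component_sum_eq[OF sub] by blast
      then show ?thesis using D[of h] by blast
    qed
    then show "X \<in> S" unfolding additive_subcat_mem_iff[OF add, of X] by blast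
  qed
  ultimately show ?thesis by (intro exI[of _ H] conjI)
qed

lemma bij_betw_component_sum:
  "bij_betw (component_sum C D) {H. subgroup H U} {S. fusion_subcat C S \<and> \<not> pointed C S}"
  unfolding bij_betw_def
proof (intro conjI inj_on_component_sum equalityI subsetI)
  fix S assume "S \<in> component_sum C D ` {H. subgroup H U}"
  then show "S \<in> {S. fusion_subcat C S \<and> \<not> pointed C S}"
    using fusion_component_sum component_sum_nonpointed by blast
next
  fix S assume "S \<in> {S. fusion_subcat C S \<and> \<not> pointed C S}"
  then show "S \<in> component_sum C D ` {H. subgroup H U}"
    using fusion_subcat_eq_component_sum[of S] by blast
qed

end

section \<open>From isomorphism classes and the type to the hypotheses used above\<close>

context fusion_category
begin

lemma noninvertible_class_iff:
  "iso_class C X \<in> Irr C UNIV - carrier (inv_group C) \<longleftrightarrow> simple_obj C X \<and> \<not> invertible_obj C X"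
proof -
  have "iso_class C X \<in> carrier (inv_group C) \<longleftrightarrow> simple_obj C X \<and> invertible_obj C X"
  proof
    assume "iso_class C X \<in> carrier (inv_group C)"
    then obtain Y where Y: "isomorphic C X Y" "simple_obj C Y" "invertible_obj C Y"
      by (auto simp: inv_group_def iso_class_eq_iff)
    note YX = isomorphic_sym[OF Y(1)]
    show "simple_obj C X \<and> invertible_obj C X"
      using isomorphic_simple[OF YX Y(2)] isomorphic_invertible[OF YX Y(3)] by (rule conjI)
  qed (auto simp: inv_group_def)
  then show ?thesis by (auto simp: Irr_iso_class_iff)
qed

end

lemma generalized_near_group_transitive:
  assumes "generalized_near_group C"
  shows "near_group_transitive C"
proof -
  interpret fusion_category C using assms by (simp add: generalized_near_group_def)
  show ?thesis
  proof
    fix Y Z assume Y: "simple_obj C Y" "\<not> invertible_obj C Y"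
      and Z: "simple_obj C Z" "\<not> invertible_obj C Z"
    have "iso_class C Y \<in> Irr C UNIV - carrier (inv_group C)"
      "iso_class C Z \<in> Irr C UNIV - carrier (inv_group C)"
      using Y Z unfolding noninvertible_class_iff by auto
    then have "iso_class C Z \<in> orbit (inv_group C) (class_tens C) (iso_class C Y)"
      using assms unfolding generalized_near_group_def by auto
    then obtain g where "g \<in> carrier (inv_group C)" "iso_class C Z = class_tens C g (iso_class C Y)"
      unfolding orbit_def by auto
    then obtain \<delta> where "simple_obj C \<delta>" "invertible_obj C \<delta>"
      "iso_class C Z = class_tens C (iso_class C \<delta>) (iso_class C Y)"
      by (auto simp: inv_group_def)
    then show "\<exists>\<delta>. simple_obj C \<delta> \<and> invertible_obj C \<delta> \<and> isomorphic C Z (\<delta> \<boxtimes>\<^bsub>C\<^esub> Y)"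
      unfolding class_tens_iso_class iso_class_eq_iff by (intro exI[of _ \<delta>] conjI)
  qed
qed

lemma near_group_type_adjoint_nonpointed:
  assumes "fusion_category C" "near_group_type C G \<Gamma> n X k" "\<exists>i\<in>{1..n}. k i \<noteq> 0"
  shows "\<not> pointed C (adjoint_subcat C)"
proof -
  interpret fusion_category C by (rule assms(1))
  obtain i where i: "i \<in> {1..n}" "k i \<noteq> 0" using assms(3) by (elim bexE)
  have "bij_betw (\<lambda>i. iso_class C (X i)) {1..n} (Irr C UNIV - carrier (inv_group C))"
    using assms(2) by (auto simp: near_group_type_def)
  then have "iso_class C (X j) \<in> Irr C UNIV - carrier (inv_group C)" if "j \<in> {1..n}" for j
    using that by (rule bij_betw_apply)
  then have X: "simple_obj C (X j)" "\<not> invertible_obj C (X j)" if "j \<in> {1..n}" for j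
    using that unfolding noninvertible_class_iff by auto
  have sum: "is_direct_sum C (\<Gamma> <+> (SIGMA i:{1..n}. {..<k i})) (case_sum iso_rep (\<lambda>(i, j). X i))
       (X 1 \<boxtimes>\<^bsub>C\<^esub> dual C (X 1))"
    using assms(2) by (auto simp: near_group_type_def)
  \<comment> \<open>The first copy of \<open>X i\<close>, which is present because
    \<open>k i\<close> is nonzero.\<close>
  have "Inr (i, 0) \<in> \<Gamma> <+> (SIGMA i:{1..n}. {..<k i})" using i by auto
  from direct_sum_is_summand[OF sum this] have "is_summand C (X i) (X 1 \<boxtimes>\<^bsub>C\<^esub> dual C (X 1))" by simp
  then have "X i \<in> adjoint_subcat C"
    using i(1) by (intro summand_in_adjoint[of "X 1"] X) simp_all
  then show ?thesis unfolding pointed_def using X[OF i(1)] by blast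
qed

theorem proposition3p6:
  fixes C :: "('o, 'm::ab_group_add, 'k::{alg_closed_field, field_char_0}) tensor_data"
    and G :: "'o set monoid" and \<Gamma> :: "'o set set"
    and n :: nat and X :: "nat \<Rightarrow> 'o" and k :: "nat \<Rightarrow> nat"
    and U :: "'u monoid" and D :: "'u \<Rightarrow> 'o set"
  assumes "generalized_near_group C"
    and "near_group_type C G \<Gamma> n X k"
    and "\<exists>i\<in>{1..n}. k i \<noteq> 0"
    and "universal_grading C U D"
  shows
    "\<not> pointed C (adjoint_subcat C) \<and>
     bij_betw (component_sum C D) {H. subgroup H U} {S. fusion_subcat C S \<and> \<not> pointed C S} \<and>
     (\<forall>g\<in>carrier U. \<exists>\<delta>\<in>D g. simple_obj C \<delta> \<and> invertible_obj C \<delta>) \<and>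
     (\<forall>g\<in>carrier U. \<forall>\<delta>\<in>D g. simple_obj C \<delta> \<and> invertible_obj C \<delta> \<longrightarrow>
        Irr C (D g) = class_tens C (iso_class C \<delta>) ` Irr C (adjoint_subcat C))"
proof -
  have fusion: "fusion_category C" using assms(1) by (simp add: generalized_near_group_def)
  interpret near_group_transitive C by (rule generalized_near_group_transitive[OF assms(1)])
  interpret near_group_universally_graded C U D
  proof
    show "universal_grading C U D" by (rule assms(4))
    show "\<not> pointed C (adjoint_subcat C)"
      by (rule near_group_type_adjoint_nonpointed[OF fusion assms(2,3)])
  qed
  show ?thesis
    using adjoint_nonpointed bij_betw_component_sum ex_invertible_of_degree Irr_degree_eq
    by (intro conjI ballI impI) auto
qed

end
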